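(* In the source coding problem with receiver side information described in the context, suppose $X=Y$ (i.e. $X_i=Y_i$ for all $i$). Then the set $\mathcal{R}$ of achievable rate triples equals the closure of $\bigcup_{p\in\mathcal{P}}\mathcal{R}_{out}^{(p)}$.
   Context: Let $\mathcal{X},\mathcal{Y},\mathcal{U},\mathcal{V}$ be finite sets and let $\{(X_i,Y_i,U_i,V_i)\}_{i\ge1}$ be i.i.d. with joint distribution $\mathcal{Q}_{XYUV}$. For $i=0,1,2$ let $\mathcal{M}_i=\{1,\dots,|\mathcal{M}_i|\}$ be finite index sets. A code of block length $n$ consists of an encoder $e^{(n)}:\mathcal{X}^n\times\mathcal{Y}^n\to\mathcal{M}_0\times\mathcal{M}_1\times\mathcal{M}_2$, $(M_0,M_1,M_2)=e^{(n)}(X^n,Y^n)$, a decoder $d_x^{(n)}:\mathcal{M}_0\times\mathcal{M}_1\times\mathcal{U}^n\to\mathcal{X}^n$, $\widehat X^n=d_x^{(n)}(M_0,M_1,U^n)$, and a decoder $d_y^{(n)}:\mathcal{M}_0\times\mathcal{M}_2\times\mathcal{V}^n\to\mathcal{Y}^n$, $\widehat Y^n=d_y^{(n)}(M_0,M_2,V^n)$. Let $P_e=\max\{\Pr[\widehat X^n\ne X^n],\Pr[\widehat Y^n\ne Y^n]\}$. A triple $(R_0,R_1,R_2)$ is achievable if for every $\epsilon>0$ and all sufficiently large $n$ there is such a code with $P_e\le\epsilon$ and $(1/n)\log_2|\mathcal{M}_i|\le R_i+\epsilon$, $i=0,1,2$; $\mathcal{R}$ is the set of achievable triples. Let $\mathcal{W}$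 be a finite set with $|\mathcal{W}|\le|\mathcal{X}||\mathcal{Y}|+3$, and let $\mathcal{P}$ be the family of probability functions $p$ on $\mathcal{W}\times\mathcal{X}\times\mathcal{Y}\times\mathcal{U}\times\mathcal{V}$ with $p(w,x,y,u,v)=p(w|x,y)p(x,y,u,v)$ and $\sum_w p(w,x,y,u,v)=\mathcal{Q}_{XYUV}(x,y,u,v)$. For $p\in\mathcal{P}$, with $J_p=\max\{I_p(X,Y;W|U),I_p(X,Y;W|V)\}$, let $\mathcal{R}_{out}^{(p)}$ be the set of $(R_0,R_1,R_2)$ with $R_0\ge J_p$, $R_0+R_1\ge J_p+H_p(X|W,U)$, $R_0+R_2\ge J_p+H_p(Y|W,V)$.
   Formalization: The rates R_0, R_1, R_2 in each R_out^(p) are additionally required to be nonnegative; without this the equality fails, since R_out^(p) would contain triples with negative R_1 or R_2, which are never achievable. *)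

theory Defs
  imports "HOL-Analysis.Analysis"
begin

text \<open>Source symbols: a letter of the i.i.d. source is a tuple (x,y,u,v) with pmf Q.
  A length-n block of the source is a list s of such tuples, length s = n.\<close>

definition seq_prob :: "('a \<Rightarrow> real) \<Rightarrow> 'a list \<Rightarrow> real" where
  "seq_prob Q s = (\<Prod>i<length s. Q (s ! i))"

definition Xs :: "('x \<times> 'y \<times> 'u \<times> 'v) list \<Rightarrow> 'x list" where
  "Xs s = map fst s"
definition Ys :: "('x \<times> 'y \<times> 'u \<times> 'v) list \<Rightarrow> 'y list" where
  "Ys s = map (\<lambda>(x,y,u,v). y) s"
definition Us :: "('x \<times> 'y \<times> 'u \<times> 'v) list \<Rightarrow> 'u list" where
  "Us s = map (\<lambda>(x,y,u,v). u) s"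
definition Vs :: "('x \<times> 'y \<times> 'u \<times> 'v) list \<Rightarrow> 'v list" where
  "Vs s = map (\<lambda>(x,y,u,v). v) s"

definition err_x :: "('x \<times> 'y \<times> 'u \<times> 'v \<Rightarrow> real) \<Rightarrow> nat
    \<Rightarrow> ('x list \<Rightarrow> 'y list \<Rightarrow> nat \<times> nat \<times> nat) \<Rightarrow> (nat \<Rightarrow> nat \<Rightarrow> 'u list \<Rightarrow> 'x list) \<Rightarrow> real" where
  "err_x Q n e dx = (\<Sum>s\<in>{s. length s = n}. seq_prob Q s *
      (let (m0, m1, m2) = e (Xs s) (Ys s) in if dx m0 m1 (Us s) \<noteq> Xs s then 1 else 0))"

definition err_y :: "('x \<times> 'y \<times> 'u \<times> 'v \<Rightarrow> real) \<Rightarrow> nat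
    \<Rightarrow> ('x list \<Rightarrow> 'y list \<Rightarrow> nat \<times> nat \<times> nat) \<Rightarrow> (nat \<Rightarrow> nat \<Rightarrow> 'v list \<Rightarrow> 'y list) \<Rightarrow> real" where
  "err_y Q n e dy = (\<Sum>s\<in>{s. length s = n}. seq_prob Q s *
      (let (m0, m1, m2) = e (Xs s) (Ys s) in if dy m0 m2 (Vs s) \<noteq> Ys s then 1 else 0))"

definition achievable :: "('x \<times> 'y \<times> 'u \<times> 'v \<Rightarrow> real) \<Rightarrow> real \<times> real \<times> real \<Rightarrow> bool" where
  "achievable Q R = (case R of (R0, R1, R2) \<Rightarrow>
     (\<forall>\<epsilon>>0. \<exists>N. \<forall>n\<ge>N. \<exists>(M0::nat) (M1::nat) (M2::nat)
        (e :: 'x list \<Rightarrow> 'y list \<Rightarrow> nat \<times> nat \<times> nat)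
        (dx :: nat \<Rightarrow> nat \<Rightarrow> 'u list \<Rightarrow> 'x list)
        (dy :: nat \<Rightarrow> nat \<Rightarrow> 'v list \<Rightarrow> 'y list).
          0 < M0 \<and> 0 < M1 \<and> 0 < M2 \<and>
          (\<forall>xs ys. length xs = n \<longrightarrow> length ys = n \<longrightarrow>
              e xs ys \<in> {1..M0} \<times> {1..M1} \<times> {1..M2}) \<and>
          max (err_x Q n e dx) (err_y Q n e dy) \<le> \<epsilon> \<and>
          log 2 (real M0) / real n \<le> R0 + \<epsilon> \<and>
          log 2 (real M1) / real n \<le> R1 + \<epsilon> \<and>
          log 2 (real M2) / real n \<le> R2 + \<epsilon>))"

text \<open>Information measures (base 2) of a pmf p supported in the finite set D,
  for random variables given as functions f, g, h of the outcome.\<close>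
definition marg :: "'a set \<Rightarrow> ('a \<Rightarrow> real) \<Rightarrow> ('a \<Rightarrow> 'b) \<Rightarrow> 'a \<Rightarrow> real" where
  "marg D p f a = (\<Sum>b\<in>{b\<in>D. f b = f a}. p b)"

definition cond_entropy :: "'a set \<Rightarrow> ('a \<Rightarrow> real) \<Rightarrow> ('a \<Rightarrow> 'b) \<Rightarrow> ('a \<Rightarrow> 'c) \<Rightarrow> real" where
  "cond_entropy D p f g =
     - (\<Sum>a\<in>D. p a * log 2 (marg D p (\<lambda>b. (f b, g b)) a / marg D p g a))"

definition cond_mutual_info :: "'a set \<Rightarrow> ('a \<Rightarrow> real) \<Rightarrow> ('a \<Rightarrow> 'b) \<Rightarrow> ('a \<Rightarrow> 'd) \<Rightarrow> ('a \<Rightarrow> 'c) \<Rightarrow> real" where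
  "cond_mutual_info D p f h g = cond_entropy D p f g - cond_entropy D p f (\<lambda>b. (h b, g b))"

definition Walph :: "'x itself \<Rightarrow> 'y itself \<Rightarrow> nat set" where
  "Walph _ _ = {0..<CARD('x) * CARD('y) + 3}"

definition Dom :: "'x itself \<Rightarrow> 'y itself \<Rightarrow> (nat \<times> 'x \<times> 'y \<times> 'u \<times> 'v) set" where
  "Dom tx ty = Walph tx ty \<times> UNIV"

definition Pfam :: "('x::finite \<times> 'y::finite \<times> 'u::finite \<times> 'v::finite \<Rightarrow> real)
    \<Rightarrow> (nat \<times> 'x \<times> 'y \<times> 'u \<times> 'v \<Rightarrow> real) set" where
  "Pfam Q = {p. (\<forall>a. 0 \<le> p a) \<and>
      (\<forall>w x y u v. w \<notin> Walph TYPE('x) TYPE('y) \<longrightarrow> p (w, x, y, u, v) = 0) \<and>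
      (\<exists>c :: nat \<Rightarrow> 'x \<Rightarrow> 'y \<Rightarrow> real. \<forall>w x y u v. p (w, x, y, u, v) = c w x y * Q (x, y, u, v)) \<and>
      (\<forall>x y u v. (\<Sum>w\<in>Walph TYPE('x) TYPE('y). p (w, x, y, u, v)) = Q (x, y, u, v))}"

definition Rout :: "(nat \<times> 'x::finite \<times> 'y::finite \<times> 'u::finite \<times> 'v::finite \<Rightarrow> real)
    \<Rightarrow> (real \<times> real \<times> real) set" where
  "Rout p = (let D = Dom TYPE('x) TYPE('y) :: (nat \<times> 'x \<times> 'y \<times> 'u \<times> 'v) set;
        W = (\<lambda>(w,x,y,u,v). w); XY = (\<lambda>(w,x,y,u,v). (x,y));
        X = (\<lambda>(w,x,y,u,v). x); Y = (\<lambda>(w,x,y,u,v). y);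
        U = (\<lambda>(w,x,y,u,v). u); V = (\<lambda>(w,x,y,u,v). v);
        J = max (cond_mutual_info D p XY W U) (cond_mutual_info D p XY W V)
     in {(R0, R1, R2). 0 \<le> R0 \<and> 0 \<le> R1 \<and> 0 \<le> R2 \<and> R0 \<ge> J \<and>
           R0 + R1 \<ge> J + cond_entropy D p X (\<lambda>a. (W a, U a)) \<and>
           R0 + R2 \<ge> J + cond_entropy D p Y (\<lambda>a. (W a, V a))})"

end

theory Submission
  imports Defs
begin

text \<open>When \<open>X = Y\<close>, both sides equal the closed region
  \<open>R\<^sub>0 + R\<^sub>1 \<ge> H(X|U)\<close>, \<open>R\<^sub>0 + R\<^sub>2 \<ge> H(X|V)\<close>, \<open>R\<^sub>i \<ge> 0\<close>.
  On the single-letter side, \<open>J\<^sub>p + H(X|W,U) \<ge> I(X;W|U) + H(X|W,U) = H(X|U)\<close> for every \<open>p\<close>,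
  and a constant \<open>W\<close> attains the bound.  On the operational side, achievability is by independent
  uniform random binning of \<open>x\<^sup>n\<close> into three indices, decoded by a likelihood threshold.
  For the converse, the decoder can be right only on as many blocks \<open>x\<^sup>n\<close> (given \<open>u\<^sup>n\<close>) as there are
  message pairs, and by Chebyshev's inequality most blocks have
  conditional probability at most \<open>2\<close> to the power \<open>-n (H(X|U) - \<delta>)\<close>.\<close>

section \<open>Blocks of a finite source\<close>

lemma finite_blocks [simp]: "finite {s :: 'a::finite list. length s = n}"
  using finite_lists_length_eq[of "UNIV :: 'a set" n] by simp

lemma map_fst_snd_inj: "map fst s = map fst t \<Longrightarrow> map snd s = map snd t \<Longrightarrow> s = t"
  by (metis zip_map_fst_snd)

lemma sum_blocks_Suc:
  fixes F :: "'a::finite list \<Rightarrow> real"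
  shows "(\<Sum>s | length s = Suc n. F s) = (\<Sum>a\<in>UNIV. \<Sum>s | length s = n. F (a # s))"
proof -
  have "{s :: 'a list. length s = Suc n} = (\<lambda>(a, s). a # s) ` (UNIV \<times> {s. length s = n})"
    by (auto simp: length_Suc_conv image_iff)
  then have "(\<Sum>s | length s = Suc n. F s)
      = (\<Sum>z\<in>UNIV \<times> {s. length s = n}. F (case z of (a, s) \<Rightarrow> a # s))"
    by (simp add: sum.reindex inj_on_def)
  also have "\<dots> = (\<Sum>a\<in>UNIV. \<Sum>s | length s = n. F (a # s))"
    by (simp add: sum.cartesian_product case_prod_unfold)
  finally show ?thesis .
qed

lemma seq_prob_Nil [simp]: "seq_prob Q [] = 1"
  by (simp add: seq_prob_def)

lemma seq_prob_Cons [simp]: "seq_prob Q (a # s) = Q a * seq_prob Q s"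
  by (simp add: seq_prob_def prod.lessThan_Suc_shift del: prod.lessThan_Suc)

lemma seq_prob_nonneg: "(\<And>a. 0 \<le> Q a) \<Longrightarrow> 0 \<le> seq_prob Q s"
  by (induction s) auto

lemma sum_seq_prob:
  fixes Q :: "'a::finite \<Rightarrow> real"
  assumes "(\<Sum>a\<in>UNIV. Q a) = 1"
  shows "(\<Sum>s | length s = n. seq_prob Q s) = 1"
proof (induction n)
  case (Suc n)
  then show ?case using assms by (simp add: sum_blocks_Suc flip: sum_distrib_left)
qed simp

section \<open>Pushforward laws and letterwise maps of i.i.d. blocks\<close>

text \<open>The law of \<open>h\<close> under \<open>p\<close>. The domain \<open>D\<close> is
  explicit because the alphabet of W is a finite subset of \<open>nat\<close>, whereas for source
  letters \<open>D\<close> is \<open>UNIV\<close>.\<close>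

definition push :: "'a set \<Rightarrow> ('a \<Rightarrow> real) \<Rightarrow> ('a \<Rightarrow> 'b) \<Rightarrow> 'b \<Rightarrow> real" where
  "push D p h b = (\<Sum>a\<in>{a\<in>D. h a = b}. p a)"

lemma sum_push:
  fixes h :: "'a \<Rightarrow> 'b::finite"
  assumes "finite D"
  shows "(\<Sum>b\<in>UNIV. push D p h b * F b) = (\<Sum>a\<in>D. p a * F (h a))"
proof -
  have "(\<Sum>b\<in>UNIV. push D p h b * F b)
      = (\<Sum>b\<in>UNIV. \<Sum>a\<in>{a\<in>D. h a = b}. p a * F (h a))"
    unfolding push_def by (intro sum.cong refl) (simp add: sum_distrib_right)
  also have "\<dots> = (\<Sum>a\<in>D. p a * F (h a))"
    using sum.group[OF assms finite, of h UNIV "\<lambda>a. p a * F (h a)"] by simp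
  finally show ?thesis .
qed

text \<open>A letterwise image of an i.i.d. block is again i.i.d., with the pushforward law. This
  reduces error probabilities over (x,y,u,v)-blocks to blocks of pairs.\<close>

lemma sum_seq_prob_push:
  fixes Q :: "'a::finite \<Rightarrow> real" and h :: "'a \<Rightarrow> 'b::finite"
  shows "(\<Sum>s | length s = n. seq_prob Q s * F (map h s))
      = (\<Sum>t | length t = n. seq_prob (push UNIV Q h) t * F t)"
proof (induction n arbitrary: F)
  case (Suc n)
  have "(\<Sum>s | length s = Suc n. seq_prob Q s * F (map h s))
      = (\<Sum>a\<in>UNIV. Q a * (\<Sum>s | length s = n. seq_prob Q s * F (h a # map h s)))"
    by (simp add: sum_blocks_Suc sum_distrib_left mult.assoc)
  also have "\<dots> = (\<Sum>a\<in>UNIV. Q a *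
      (\<Sum>t | length t = n. seq_prob (push UNIV Q h) t * F (h a # t)))"
    using Suc[of "\<lambda>t. F (_ # t)"] by simp
  also have "\<dots> = (\<Sum>b\<in>UNIV. push UNIV Q h b *
      (\<Sum>t | length t = n. seq_prob (push UNIV Q h) t * F (b # t)))"
    by (rule sum_push[symmetric]) simp
  finally show ?case
    by (simp add: sum_blocks_Suc sum_distrib_left mult.assoc)
qed simp

section \<open>Second moments and Chebyshev's inequality\<close>

text \<open>Independence and mean zero kill the cross term when a letter is prepended, so the second
  moment grows by the same amount with each letter.\<close>

lemma sum_seq_prob_square:
  fixes Q :: "'a::finite \<Rightarrow> real"
  assumes Q1: "(\<Sum>a\<in>UNIV. Q a) = 1" and mean: "(\<Sum>a\<in>UNIV. Q a * Z a) = 0"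
  shows "(\<Sum>s | length s = n. seq_prob Q s * (\<Sum>a\<leftarrow>s. Z a)\<^sup>2) = n * (\<Sum>a\<in>UNIV. Q a * (Z a)\<^sup>2)"
proof (induction n)
  case (Suc n)
  let ?S = "\<lambda>s. \<Sum>a\<leftarrow>s. Z a"
  let ?E = "\<lambda>F. \<Sum>s | length s = n. seq_prob Q s * F s"
  have "(\<Sum>s | length s = Suc n. seq_prob Q s * (?S s)\<^sup>2)
      = (\<Sum>a\<in>UNIV. \<Sum>s | length s = n. Q a * (Z a)\<^sup>2 * seq_prob Q s
          + Q a * Z a * (2 * (seq_prob Q s * ?S s)) + Q a * (seq_prob Q s * (?S s)\<^sup>2))"
    unfolding sum_blocks_Suc
    by (intro sum.cong refl) (simp add: algebra_simps power2_eq_square)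
  also have "\<dots> = (\<Sum>a\<in>UNIV. Q a * (Z a)\<^sup>2 * (\<Sum>s | length s = n. seq_prob Q s)
      + Q a * Z a * (2 * ?E ?S) + Q a * ?E (\<lambda>s. (?S s)\<^sup>2))"
    by (simp only: sum.distrib sum_distrib_left)
  also have "\<dots> = (\<Sum>a\<in>UNIV. Q a * (Z a)\<^sup>2) + ?E (\<lambda>s. (?S s)\<^sup>2)"
    by (simp only: sum_seq_prob[OF Q1] sum.distrib Q1 mean mult_1_right mult_1_left mult_zero_left
        add_0_right flip: sum_distrib_right)
  finally show ?case by (simp add: Suc algebra_simps)
qed simp

text \<open>On the event, the square of the sum divided by (n \<delta>)^2 is at least 1; averaging
  this pointwise bound and inserting the second moment gives the inequality.\<close>

lemma seq_prob_chebyshev: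
  fixes Q :: "'a::finite \<Rightarrow> real"
  assumes Q0: "\<And>a. 0 \<le> Q a" and Q1: "(\<Sum>a\<in>UNIV. Q a) = 1"
    and mean: "(\<Sum>a\<in>UNIV. Q a * Z a) = 0" and "0 < n" "0 < \<delta>"
  shows "(\<Sum>s | length s = n. seq_prob Q s * of_bool (n * \<delta> \<le> \<bar>\<Sum>a\<leftarrow>s. Z a\<bar>))
      \<le> (\<Sum>a\<in>UNIV. Q a * (Z a)\<^sup>2) / (n * \<delta>\<^sup>2)"
proof -
  have "seq_prob Q s * of_bool (n * \<delta> \<le> \<bar>\<Sum>a\<leftarrow>s. Z a\<bar>)
      \<le> seq_prob Q s * (\<Sum>a\<leftarrow>s. Z a)\<^sup>2 / (n * \<delta>)\<^sup>2" for s
  proof (cases "n * \<delta> \<le> \<bar>\<Sum>a\<leftarrow>s. Z a\<bar>")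
    case True
    then have "(n * \<delta>)\<^sup>2 \<le> (\<Sum>a\<leftarrow>s. Z a)\<^sup>2"
      using assms by (metis abs_le_square_iff abs_of_pos mult_pos_pos of_nat_0_less_iff)
    then have "seq_prob Q s * 1 \<le> seq_prob Q s * ((\<Sum>a\<leftarrow>s. Z a)\<^sup>2 / (n * \<delta>)\<^sup>2)"
      using assms seq_prob_nonneg[of Q s, OF Q0] by (intro mult_left_mono) (auto simp: field_simps)
    then show ?thesis using True by simp
  qed (use seq_prob_nonneg[of Q s, OF Q0] in simp)
  then have "(\<Sum>s | length s = n. seq_prob Q s * of_bool (n * \<delta> \<le> \<bar>\<Sum>a\<leftarrow>s. Z a\<bar>))
      \<le> (\<Sum>s | length s = n. seq_prob Q s * (\<Sum>a\<leftarrow>s. Z a)\<^sup>2) / (n * \<delta>)\<^sup>2"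
    unfolding sum_divide_distrib by (intro sum_mono)
  also have "\<dots> = (\<Sum>a\<in>UNIV. Q a * (Z a)\<^sup>2) / (n * \<delta>\<^sup>2)"
    using assms(4) unfolding sum_seq_prob_square[OF Q1 mean] by (simp add: power2_eq_square)
  finally show ?thesis .
qed

text \<open>Both the converse and the achievability bound have this shape: a Chebyshev term of order
  1/n plus an exponentially small counting term.\<close>

lemma chebyshev_powr_tendsto_0:
  fixes a b c d :: real
  assumes "0 < a"
  shows "(\<lambda>n. c / (real n * d) + b * 2 powr (- (real n * a))) \<longlonglongrightarrow> 0"
proof -
  have "2 powr (- (real n * a)) = (2 powr (- a)) ^ n" for n
    by (simp add: powr_power mult.commute)
  moreover have "(\<lambda>n. (2 powr (- a)) ^ n) \<longlonglongrightarrow> 0"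
    using assms powr_less_mono[of "- a" 0 2] by (intro LIMSEQ_realpow_zero) auto
  ultimately have "(\<lambda>n. b * 2 powr (- (real n * a))) \<longlonglongrightarrow> b * 0"
    by (intro tendsto_mult_left) simp
  moreover have "(\<lambda>n. (c / d) / real n) \<longlonglongrightarrow> 0"
    by (rule lim_const_over_n)
  ultimately show ?thesis
    using tendsto_add by (fastforce simp: mult.commute)
qed

section \<open>Lossless coding with receiver side information\<close>

text \<open>The conditional probability of x given u. It is 0 when u has mass 0, because division by
  zero gives 0; hence its sums over x are in general only at most 1.\<close>

definition cond_pmf :: "('x::finite \<times> 'u \<Rightarrow> real) \<Rightarrow> 'x \<times> 'u \<Rightarrow> real" where
  "cond_pmf P = (\<lambda>(x, u). P (x, u) / (\<Sum>x'\<in>UNIV. P (x', u)))"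

text \<open>The conditional entropy H(X|U) in bits when (X,U) has law \<open>P\<close>.\<close>

definition pair_entropy :: "('x::finite \<times> 'u::finite \<Rightarrow> real) \<Rightarrow> real" where
  "pair_entropy P = - (\<Sum>b\<in>UNIV. P b * log 2 (cond_pmf P b))"

text \<open>The variance of the conditional information -log P(x|u), which is the constant in the
  Chebyshev bound.\<close>

definition info_var :: "('x::finite \<times> 'u::finite \<Rightarrow> real) \<Rightarrow> real" where
  "info_var P = (\<Sum>b\<in>UNIV. P b * (- log 2 (cond_pmf P b) - pair_entropy P)\<^sup>2)"

locale pair_source =
  fixes P :: "'x::finite \<times> 'u::finite \<Rightarrow> real"
  assumes P_nonneg: "\<And>b. 0 \<le> P b" and P_sum: "(\<Sum>b\<in>UNIV. P b) = 1"
begin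

abbreviation "H \<equiv> pair_entropy P"
text \<open>On a block of pairs, \<open>q\<close> is the conditional probability of x^n given
  u^n.\<close>

abbreviation "q \<equiv> seq_prob (cond_pmf P)"

definition PU :: "'u \<Rightarrow> real" where "PU u = (\<Sum>x\<in>UNIV. P (x, u))"

lemma PU_nonneg: "0 \<le> PU u"
  by (simp add: PU_def P_nonneg sum_nonneg)

lemma PU_sum: "(\<Sum>u\<in>UNIV. PU u) = 1"
  using P_sum unfolding PU_def
  by (subst sum.swap) (simp add: sum.cartesian_product flip: UNIV_Times_UNIV)

lemma cond_pmf_nonneg: "0 \<le> cond_pmf P b"
  by (cases b) (simp add: cond_pmf_def P_nonneg sum_nonneg)

lemma P_le_PU: "P (x, u) \<le> PU u"
  unfolding PU_def by (rule member_le_sum) (auto simp: P_nonneg)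

text \<open>The chain rule. If u has mass 0, then \<open>P_le_PU\<close> forces the joint mass to
  vanish too, so both sides are 0.\<close>

lemma P_eq_cond_pmf: "P b = cond_pmf P b * PU (snd b)"
proof (cases b)
  case (Pair x u)
  then show ?thesis using P_le_PU[of x u] P_nonneg[of b]
    by (cases "PU u = 0") (auto simp: cond_pmf_def simp flip: PU_def)
qed

lemma seq_prob_P: "seq_prob P t = q t * seq_prob PU (map snd t)"
proof (induction t)
  case (Cons b t)
  then show ?case using P_eq_cond_pmf[of b] by simp
qed simp

lemma sum_cond_pmf_le: "(\<Sum>x\<in>UNIV. cond_pmf P (x, u)) \<le> 1"
  by (cases "PU u = 0") (auto simp: cond_pmf_def simp flip: PU_def sum_divide_distrib)

text \<open>The sum over blocks factors into letterwise sums, each at most 1.\<close>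

lemma sum_q_zip_le: "(\<Sum>xs | length xs = length us. q (zip xs us)) \<le> 1"
proof (induction us)
  case (Cons u us)
  have "(\<Sum>xs | length xs = length (u # us). q (zip xs (u # us)))
      = (\<Sum>x\<in>UNIV. cond_pmf P (x, u)) * (\<Sum>xs | length xs = length us. q (zip xs us))"
    by (simp add: sum_blocks_Suc sum_product)
  also have "\<dots> \<le> 1 * 1"
    using Cons sum_cond_pmf_le
    by (intro mult_mono) (auto intro!: sum_nonneg seq_prob_nonneg cond_pmf_nonneg)
  finally show ?case by simp
qed simp

text \<open>Here -log q is split into its mean n H and a sum of centred terms, to which Chebyshev
  applies. The hypothesis makes every factor positive, so each is 2 to the power of its
  logarithm.\<close>

lemma q_eq_powr:
  assumes "seq_prob P t \<noteq> 0"
  shows "q t = 2 powr (- (\<Sum>b\<leftarrow>t. - log 2 (cond_pmf P b) - H) - length t * H)"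
  using assms
proof (induction t)
  case (Cons b t)
  then have "P b \<noteq> 0" by simp
  then have "0 < cond_pmf P b"
    using P_eq_cond_pmf[of b] cond_pmf_nonneg[of b] by (cases "cond_pmf P b = 0") auto
  then have "cond_pmf P b = 2 powr log 2 (cond_pmf P b)" by simp
  then have "q (b # t) = 2 powr log 2 (cond_pmf P b) * q t" by simp
  also have "\<dots> = 2 powr (log 2 (cond_pmf P b)
      + (- (\<Sum>b\<leftarrow>t. - log 2 (cond_pmf P b) - H) - length t * H))"
    using Cons by (simp only: powr_add) simp
  finally show ?case by (simp add: algebra_simps)
qed simp

text \<open>By \<open>q_eq_powr\<close>, either deviation of \<open>q\<close> moves the centred sum
  by at least n \<delta>; blocks of probability 0 contribute nothing. The predicate \<open>A\<close>
  covers both tails: the converse uses too large \<open>q\<close>, the decoder too small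
  \<open>q\<close>.\<close>

lemma atypical_prob:
  assumes "0 < n" "0 < \<delta>"
    and A: "\<And>t. length t = n \<Longrightarrow> A t \<Longrightarrow> 2 powr (- (n * (H - \<delta>))) < q t \<or> q t < 2 powr (- (n * (H + \<delta>)))"
  shows "(\<Sum>t | length t = n. seq_prob P t * of_bool (A t)) \<le> info_var P / (n * \<delta>\<^sup>2)"
proof -
  let ?Z = "\<lambda>b. - log 2 (cond_pmf P b) - H"
  have "(\<Sum>b\<in>UNIV. P b * ?Z b)
      = - (\<Sum>b\<in>UNIV. P b * log 2 (cond_pmf P b)) - (\<Sum>b\<in>UNIV. P b) * H"
    by (simp add: right_diff_distrib sum_subtractf sum_negf sum_distrib_right)
  then have mean: "(\<Sum>b\<in>UNIV. P b * ?Z b) = 0"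
    by (simp add: P_sum pair_entropy_def)
  have "seq_prob P t * of_bool (A t)
      \<le> seq_prob P t * of_bool (n * \<delta> \<le> \<bar>\<Sum>b\<leftarrow>t. ?Z b\<bar>)" if "length t = n" for t
  proof (cases "A t \<and> seq_prob P t \<noteq> 0")
    case True
    then have "2 powr (- (n * (H - \<delta>))) < q t \<or> q t < 2 powr (- (n * (H + \<delta>)))"
      using A that by blast
    then have "n * \<delta> \<le> \<bar>\<Sum>b\<leftarrow>t. ?Z b\<bar>"
      using True that by (subst (asm) (1 2) q_eq_powr) (auto simp: algebra_simps)
    then show ?thesis using True by simp
  qed (use seq_prob_nonneg[of P t] P_nonneg in auto)
  then have "(\<Sum>t | length t = n. seq_prob P t * of_bool (A t))
      \<le> (\<Sum>t | length t = n. seq_prob P t * of_bool (n * \<delta> \<le> \<bar>\<Sum>b\<leftarrow>t. ?Z b\<bar>))"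
    by (intro sum_mono) simp
  also have "\<dots> \<le> info_var P / (n * \<delta>\<^sup>2)"
    unfolding info_var_def
    by (rule seq_prob_chebyshev[OF P_nonneg P_sum mean assms(1,2)])
  finally show ?thesis .
qed

section \<open>Probability of correct decoding from few messages\<close>

text \<open>A guessing rule \<open>d\<close> is right for at most one x^n per u^n, so
  \<open>map snd\<close> is injective on the success set, and each success weighs at most \<tau>
  times the probability of u^n.\<close>

lemma single_guess_prob:
  assumes "0 \<le> \<tau>"
  shows "(\<Sum>t | length t = n. seq_prob P t * of_bool (map fst t = d (map snd t) \<and> q t \<le> \<tau>)) \<le> \<tau>"
proof -
  let ?S = "{t. length t = n \<and> map fst t = d (map snd t) \<and> q t \<le> \<tau>}"
  have inj: "inj_on (map snd) ?S"
    by (rule inj_onI) (auto intro!: map_fst_snd_inj)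
  have "(\<Sum>t | length t = n. seq_prob P t * of_bool (map fst t = d (map snd t) \<and> q t \<le> \<tau>))
      = (\<Sum>t\<in>?S. seq_prob P t)"
    by (rule sum.mono_neutral_cong_right) auto
  also have "\<dots> \<le> (\<Sum>t\<in>?S. \<tau> * seq_prob PU (map snd t))"
    by (intro sum_mono) (auto simp: seq_prob_P intro!: mult_right_mono seq_prob_nonneg PU_nonneg)
  also have "\<dots> = \<tau> * (\<Sum>us\<in>map snd ` ?S. seq_prob PU us)"
    by (simp add: sum.reindex[OF inj] sum_distrib_left)
  also have "\<dots> \<le> \<tau> * (\<Sum>us | length us = n. seq_prob PU us)"
    using assms by (intro mult_left_mono sum_mono2) (auto simp: seq_prob_nonneg PU_nonneg)
  finally show ?thesis by (simp add: sum_seq_prob PU_sum)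
qed

text \<open>Given \<open>us\<close>, at most \<open>card K\<close> blocks are decoded correctly, and a typical one
  has conditional probability at most \<open>2 powr (- n * (H - \<delta>))\<close>.\<close>

lemma correct_prob_le:
  assumes "finite K" "\<And>t. length t = n \<Longrightarrow> m t \<in> K" "0 < n" "0 < \<delta>"
  shows "(\<Sum>t | length t = n. seq_prob P t * of_bool (d (m t) (map snd t) = map fst t))
      \<le> info_var P / (n * \<delta>\<^sup>2) + card K * 2 powr (- (n * (H - \<delta>)))"
proof -
  define \<tau> where "\<tau> = 2 powr (- (n * (H - \<delta>)))"
  let ?g = "\<lambda>k t. seq_prob P t * of_bool (map fst t = d k (map snd t) \<and> q t \<le> \<tau>)"
  have g0: "0 \<le> ?g k t" for k t by (simp add: seq_prob_nonneg P_nonneg)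
  \<comment> \<open>The message depends on the block, whereas \<open>single_guess_prob\<close> needs
    a fixed rule; summing over all messages \<open>k\<close> dominates the one actually
    sent.\<close>
  have "seq_prob P t * of_bool (d (m t) (map snd t) = map fst t)
      \<le> seq_prob P t * of_bool (\<tau> < q t) + (\<Sum>k\<in>K. ?g k t)" if "length t = n" for t
  proof -
    have "?g (m t) t \<le> (\<Sum>k\<in>K. ?g k t)"
      using assms that g0 by (intro member_le_sum) auto
    moreover have "seq_prob P t * of_bool (d (m t) (map snd t) = map fst t)
        \<le> seq_prob P t * of_bool (\<tau> < q t) + ?g (m t) t"
      by (auto simp: seq_prob_nonneg P_nonneg not_less)
    ultimately show ?thesis by linarith
  qed
  then have "(\<Sum>t | length t = n. seq_prob P t * of_bool (d (m t) (map snd t) = map fst t))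
      \<le> (\<Sum>t | length t = n. seq_prob P t * of_bool (\<tau> < q t) + (\<Sum>k\<in>K. ?g k t))"
    by (intro sum_mono) simp
  also have "\<dots> = (\<Sum>t | length t = n. seq_prob P t * of_bool (\<tau> < q t))
      + (\<Sum>k\<in>K. \<Sum>t | length t = n. ?g k t)"
    unfolding sum.distrib by (subst (2) sum.swap) (rule refl)
  also have "\<dots> \<le> info_var P / (n * \<delta>\<^sup>2) + card K * \<tau>"
    using assms by (intro add_mono atypical_prob sum_bounded_above single_guess_prob)
      (auto simp: \<tau>_def)
  finally show ?thesis by (simp add: \<tau>_def)
qed

section \<open>Threshold decoding of random bins\<close>

text \<open>The decoder picks some block in bin \<open>k\<close> whose conditional probability given
  u^n reaches \<tau>; the result is arbitrary if there is none. The bin type is left open so that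
  each receiver can use its own pair of indices.\<close>

definition dec :: "nat \<Rightarrow> real \<Rightarrow> ('x list \<Rightarrow> 'm) \<Rightarrow> 'm \<Rightarrow> 'u list \<Rightarrow> 'x list" where
  "dec n \<tau> f k us = (SOME xs. length xs = n \<and> f xs = k \<and> \<tau> \<le> q (zip xs us))"

text \<open>Each counted block takes at least \<tau> out of a total conditional mass of at most
  1.\<close>

lemma card_likely_le:
  assumes "0 < \<tau>"
  shows "card {xs. length xs = length us \<and> \<tau> \<le> q (zip xs us)} \<le> 1 / \<tau>"
proof -
  let ?L = "{xs. length xs = length us \<and> \<tau> \<le> q (zip xs us)}"
  have "card ?L * \<tau> \<le> (\<Sum>xs\<in>?L. q (zip xs us))"
    by (rule sum_bounded_below) simp
  also have "\<dots> \<le> (\<Sum>xs | length xs = length us. q (zip xs us))"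
    by (intro sum_mono2) (auto simp: seq_prob_nonneg cond_pmf_nonneg)
  also have "\<dots> \<le> 1" by (rule sum_q_zip_le)
  finally show ?thesis using assms by (simp add: field_simps)
qed

text \<open>An error means that the true block misses the threshold or that another block reaching
  it lies in the same bin. In the second case the decoder's output itself is such a block.\<close>

lemma dec_error_le:
  assumes "length t = n"
  shows "of_bool (dec n \<tau> f (f (map fst t)) (map snd t) \<noteq> map fst t)
    \<le> of_bool (q t < \<tau>) + (\<Sum>xs\<in>{xs. length xs = n \<and> \<tau> \<le> q (zip xs (map snd t))} - {map fst t}.
        (of_bool (f xs = f (map fst t)) :: real))"
    (is "_ \<le> _ + (\<Sum>xs\<in>?L - _. ?c xs)")
proof (cases "q t < \<tau> \<or> dec n \<tau> f (f (map fst t)) (map snd t) = map fst t")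
  case True
  then show ?thesis by (auto intro!: add_nonneg_nonneg sum_nonneg)
next
  case False
  let ?xs = "dec n \<tau> f (f (map fst t)) (map snd t)"
  have "length (map fst t) = n \<and> f (map fst t) = f (map fst t) \<and> \<tau> \<le> q (zip (map fst t) (map snd t))"
    using False assms by (simp add: zip_map_fst_snd not_less)
  then have xs: "length ?xs = n \<and> f ?xs = f (map fst t) \<and> \<tau> \<le> q (zip ?xs (map snd t))"
    unfolding dec_def by (rule someI)
  have "finite (?L - {map fst t})"
    by (rule finite_subset[OF _ finite_blocks[of n]]) auto
  moreover have "?xs \<in> ?L - {map fst t}" using xs False by auto
  ultimately have "?c ?xs \<le> (\<Sum>xs\<in>?L - {map fst t}. ?c xs)"
    by (intro member_le_sum) auto
  then show ?thesis using xs False by simp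
qed

text \<open>At most 1/\<tau> competitors reach the threshold, and each collides with the true block
  for at most a fraction 1/M of the binnings in \<open>F\<close>. The map \<pi> selects the indices
  that the receiver sees.\<close>

lemma average_dec_error_le:
  assumes "finite F" "0 < M" "0 < n" "0 < \<delta>"
    and coll: "\<And>xs xs'. length xs = n \<Longrightarrow> length xs' = n \<Longrightarrow> xs \<noteq> xs' \<Longrightarrow>
      (\<Sum>f\<in>F. of_bool (\<pi> (f xs) = \<pi> (f xs'))) \<le> card F / (M::real)"
  shows "(\<Sum>f\<in>F. \<Sum>t | length t = n. seq_prob P t *
        of_bool (dec n (2 powr (- (n * (H + \<delta>)))) (\<lambda>xs. \<pi> (f xs)) (\<pi> (f (map fst t))) (map snd t) \<noteq> map fst t))
      \<le> card F * (info_var P / (n * \<delta>\<^sup>2) + 2 powr (n * (H + \<delta>)) / M)"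
proof -
  define \<tau> where "\<tau> = 2 powr (- (n * (H + \<delta>)))"
  have \<tau>: "0 < \<tau>" "1 / \<tau> = 2 powr (n * (H + \<delta>))"
    by (simp_all add: \<tau>_def powr_minus_divide)
  let ?L = "\<lambda>t. {xs. length xs = n \<and> \<tau> \<le> q (zip xs (map snd t))} - {map fst t}"
  let ?c = "\<lambda>f t xs. of_bool (\<pi> (f xs) = \<pi> (f (map fst t))) :: real"
  have cL: "(\<Sum>f\<in>F. \<Sum>xs\<in>?L t. ?c f t xs) \<le> card F * (1 / \<tau> / M)" if "length t = n" for t
  proof -
    have fin: "finite {xs. length xs = n \<and> \<tau> \<le> q (zip xs (map snd t))}"
      by (rule finite_subset[OF _ finite_blocks[of n]]) auto
    then have "card (?L t) \<le> card {xs. length xs = n \<and> \<tau> \<le> q (zip xs (map snd t))}"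
      by (intro card_mono) auto
    also have "\<dots> \<le> 1 / \<tau>"
      using card_likely_le[OF \<tau>(1), of "map snd t"] that by simp
    finally have card: "card (?L t) \<le> 1 / \<tau>" by simp
    have "(\<Sum>f\<in>F. \<Sum>xs\<in>?L t. ?c f t xs) = (\<Sum>xs\<in>?L t. \<Sum>f\<in>F. ?c f t xs)"
      by (rule sum.swap)
    also have "\<dots> \<le> card (?L t) * (card F / M)"
      using that by (intro sum_bounded_above coll) auto
    also have "\<dots> \<le> 1 / \<tau> * (card F / M)"
      using card assms by (intro mult_right_mono) auto
    finally show ?thesis by (simp add: field_simps)
  qed
  have "(\<Sum>f\<in>F. \<Sum>t | length t = n. seq_prob P t *
        of_bool (dec n \<tau> (\<lambda>xs. \<pi> (f xs)) (\<pi> (f (map fst t))) (map snd t) \<noteq> map fst t))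
      \<le> (\<Sum>f\<in>F. \<Sum>t | length t = n. seq_prob P t * (of_bool (q t < \<tau>) + (\<Sum>xs\<in>?L t. ?c f t xs)))"
    using dec_error_le[where f = "\<lambda>xs. \<pi> (_ xs)"]
    by (intro sum_mono mult_left_mono) (auto simp: seq_prob_nonneg P_nonneg)
  \<comment> \<open>The average over binnings moves inside: the threshold event is the same for all
    \<open>f\<close>, so only the collision count is averaged.\<close>
  also have "\<dots> = (\<Sum>t | length t = n. seq_prob P t *
      (real (card F) * of_bool (q t < \<tau>) + (\<Sum>f\<in>F. \<Sum>xs\<in>?L t. ?c f t xs)))"
    by (subst sum.swap) (simp only: sum.distrib sum_constant flip: sum_distrib_left)
  also have "\<dots> \<le> (\<Sum>t | length t = n. seq_prob P t *
      (real (card F) * of_bool (q t < \<tau>) + card F * (1 / \<tau> / M)))"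
    using cL by (intro sum_mono mult_left_mono add_left_mono) (auto simp: seq_prob_nonneg P_nonneg)
  also have "\<dots> = card F * ((\<Sum>t | length t = n. seq_prob P t * of_bool (q t < \<tau>))
      + (\<Sum>t | length t = n. seq_prob P t) * (1 / \<tau> / M))"
    by (simp add: distrib_left sum.distrib sum_distrib_left sum_distrib_right mult_ac
        del: sum_mult_of_bool_eq sum_of_bool_mult_eq)
  also have "\<dots> \<le> card F * (info_var P / (n * \<delta>\<^sup>2) + 1 * (1 / \<tau> / M))"
    using assms unfolding sum_seq_prob[OF P_sum]
    by (intro mult_left_mono add_right_mono atypical_prob) (auto simp: \<tau>_def)
  finally show ?thesis by (simp add: \<tau>(2) \<tau>_def[symmetric])
qed

end

text \<open>If R < H, the probability of correct decoding would tend to 0 while staying at least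
  1/2. The slack is 2 \<epsilon> since a receiver sees two indices, each with excess \<epsilon>; at
  n = 0 a rate divided by n bounds no cardinality, hence the guard.\<close>

lemma (in pair_source) converse_rate:
  assumes "\<And>\<epsilon>. 0 < \<epsilon> \<Longrightarrow> \<exists>N. \<forall>n\<ge>N. \<exists>(K :: 'm set) m d. finite K \<and> (\<forall>t. length t = n \<longrightarrow> m t \<in> K) \<and>
      (\<Sum>t | length t = n. seq_prob P t * of_bool (d (m t) (map snd t) \<noteq> map fst t)) \<le> \<epsilon> \<and>
      (0 < n \<longrightarrow> card K \<le> 2 powr (n * (R + 2 * \<epsilon>)))"
  shows "H \<le> R"
proof (rule ccontr)
  assume "\<not> H \<le> R"
  \<comment> \<open>A quarter of the gap: with 2 \<epsilon> at most \<delta>, the exponent R + 2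
    \<epsilon> - H + \<delta> is at most -2 \<delta>. The other bound on \<epsilon> keeps the
    success probability at least 1/2.\<close>
  define \<delta> where "\<delta> = (H - R) / 4"
  have \<delta>: "0 < \<delta>" using \<open>\<not> H \<le> R\<close> by (simp add: \<delta>_def)
  define \<epsilon> where "\<epsilon> = min (\<delta> / 2) (1 / 2)"
  have \<epsilon>: "0 < \<epsilon>" "2 * \<epsilon> \<le> \<delta>" "\<epsilon> \<le> 1 / 2" using \<delta> by (auto simp: \<epsilon>_def)
  obtain N where N: "\<And>n. N \<le> n \<Longrightarrow> \<exists>(K :: 'm set) m d. finite K \<and> (\<forall>t. length t = n \<longrightarrow> m t \<in> K) \<and>
      (\<Sum>t | length t = n. seq_prob P t * of_bool (d (m t) (map snd t) \<noteq> map fst t)) \<le> \<epsilon> \<and>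
      (0 < n \<longrightarrow> card K \<le> 2 powr (n * (R + 2 * \<epsilon>)))"
    using assms[OF \<epsilon>(1)] by blast
  have bound: "1 / 2 \<le> info_var P / (n * \<delta>\<^sup>2) + 2 powr (- (2 * \<delta> * n))" if n: "N \<le> n" "0 < n" for n
  proof -
    obtain K :: "'m set" and m d where K: "finite K" "\<And>t. length t = n \<Longrightarrow> m t \<in> K"
        "(\<Sum>t | length t = n. seq_prob P t * of_bool (d (m t) (map snd t) \<noteq> map fst t)) \<le> \<epsilon>"
        "card K \<le> 2 powr (n * (R + 2 * \<epsilon>))"
      using N[OF n(1)] n(2) by blast
    have "1 = (\<Sum>t | length t = n. seq_prob P t * of_bool (d (m t) (map snd t) = map fst t)
        + seq_prob P t * of_bool (d (m t) (map snd t) \<noteq> map fst t))"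
      unfolding sum_seq_prob[OF P_sum, of n, symmetric] by (intro sum.cong) auto
    then have "1 / 2 \<le> (\<Sum>t | length t = n. seq_prob P t * of_bool (d (m t) (map snd t) = map fst t))"
      using K(3) \<epsilon>(3) unfolding sum.distrib by linarith
    also have "\<dots> \<le> info_var P / (n * \<delta>\<^sup>2) + card K * 2 powr (- (n * (H - \<delta>)))"
      by (rule correct_prob_le[OF K(1,2) n(2) \<delta>])
    also have "card K * 2 powr (- (n * (H - \<delta>)))
        \<le> 2 powr (n * (R + 2 * \<epsilon>)) * 2 powr (- (n * (H - \<delta>)))"
      using K(4) by (intro mult_right_mono) auto
    also have "\<dots> = 2 powr (n * (R + 2 * \<epsilon> - H + \<delta>))"
      by (simp add: powr_add[symmetric] algebra_simps)
    also have "\<dots> \<le> 2 powr (n * (- 2 * \<delta>))"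
    proof -
      have "H - R = 4 * \<delta>" by (simp add: \<delta>_def)
      then have "R + 2 * \<epsilon> - H + \<delta> \<le> - 2 * \<delta>" using \<epsilon>(2) by linarith
      then show ?thesis by (intro powr_mono mult_left_mono) auto
    qed
    finally show ?thesis by (simp add: mult_ac)
  qed
  have "((\<lambda>n. info_var P / (real n * \<delta>\<^sup>2) + 2 powr (- (2 * \<delta> * real n))) \<longlongrightarrow> 0) sequentially"
    using chebyshev_powr_tendsto_0[of "2 * \<delta>" "info_var P" "\<delta>\<^sup>2" 1] \<delta>
    by (simp add: mult_ac)
  then have "\<forall>\<^sub>F n in sequentially. info_var P / (real n * \<delta>\<^sup>2) + 2 powr (- (2 * \<delta> * real n)) < 1 / 2"
    by (rule order_tendstoD) simp
  then obtain n0 where n0: "\<And>n. n0 \<le> n \<Longrightarrow>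
      info_var P / (real n * \<delta>\<^sup>2) + 2 powr (- (2 * \<delta> * real n)) < 1 / 2"
    by (auto simp: eventually_sequentially)
  define n where "n = Suc (max n0 N)"
  have "n0 \<le> n" "N \<le> n" "0 < n" by (auto simp: n_def)
  then show False using n0[of n] bound[of n] by linarith
qed

text \<open>With \<open>f\<close> fixed off \<open>x\<close>, the value at \<open>x\<close> is
  uniform on \<open>B\<close>, and it hits the fibre of \<open>f x'\<close> in a fraction 1/M of the
  cases because that fibre has \<open>card B\<close> / M elements.\<close>

lemma collision_average:
  assumes "finite A" "finite B" "x \<in> A" "x' \<in> A" "x \<noteq> x'" "0 < M"
    and fibre: "\<And>b. b \<in> B \<Longrightarrow> M * card {b' \<in> B. \<pi> b' = \<pi> b} = card B"
  shows "(\<Sum>f\<in>(A \<rightarrow>\<^sub>E B). of_bool (\<pi> (f x) = \<pi> (f x'))) \<le> real (card (A \<rightarrow>\<^sub>E B)) / real M"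
proof -
  define A' where "A' = A - {x}"
  have A: "A = insert x A'" "x \<notin> A'" "x' \<in> A'" using assms by (auto simp: A'_def)
  have fin: "finite A'" using assms by (simp add: A'_def)
  have inj: "inj_on (\<lambda>(y, g). g(x := y)) (B \<times> (A' \<rightarrow>\<^sub>E B))"
    using inj_combinator[OF A(2), of "\<lambda>_. B"] by simp
  \<comment> \<open>A function on \<open>A\<close> is its value at \<open>x\<close> together with
    its restriction to the remaining points, which include \<open>x'\<close>.\<close>
  have eq: "(A \<rightarrow>\<^sub>E B) = (\<lambda>(y, g). g(x := y)) ` (B \<times> (A' \<rightarrow>\<^sub>E B))"
    unfolding A(1) by (rule PiE_insert_eq)
  have "(\<Sum>f\<in>(A \<rightarrow>\<^sub>E B). of_bool (\<pi> (f x) = \<pi> (f x')) :: real)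
      = (\<Sum>(y, g)\<in>B \<times> (A' \<rightarrow>\<^sub>E B). of_bool (\<pi> y = \<pi> (g x')))"
    unfolding eq sum.reindex[OF inj] using assms(5) by (intro sum.cong) auto
  also have "\<dots> = (\<Sum>g\<in>(A' \<rightarrow>\<^sub>E B). \<Sum>y\<in>B. of_bool (\<pi> y = \<pi> (g x')))"
    by (subst sum.swap) (simp add: sum.cartesian_product)
  also have "\<dots> = (\<Sum>g\<in>(A' \<rightarrow>\<^sub>E B). real (card B) / M)"
  proof (rule sum.cong[OF refl])
    fix g assume "g \<in> A' \<rightarrow>\<^sub>E B"
    then have "g x' \<in> B" using A(3) by auto
    have "(\<Sum>y\<in>B. of_bool (\<pi> y = \<pi> (g x')) :: real) = card {y \<in> B. \<pi> y = \<pi> (g x')}"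
      using assms(2) by (simp add: Int_def)
    also have "\<dots> = real (card B) / M"
      using fibre[OF \<open>g x' \<in> B\<close>] assms(6)
      by (metis nonzero_mult_div_cancel_left of_nat_mult of_nat_0_less_iff less_irrefl)
    finally show "(\<Sum>y\<in>B. of_bool (\<pi> y = \<pi> (g x')) :: real) = real (card B) / M" .
  qed
  also have "\<dots> = real (card (A \<rightarrow>\<^sub>E B)) / M"
    unfolding eq by (simp add: card_image[OF inj] card_cartesian_product)
  finally show ?thesis by simp
qed


section \<open>The two descriptions of the rate region\<close>

text \<open>Conditional entropy depends only on the joint law of the two variables, so it can be
  computed on pairs once W no longer occurs.\<close>

lemma cond_entropy_eq_pair_entropy:
  fixes f :: "'a \<Rightarrow> 'x::finite" and g :: "'a \<Rightarrow> 'u::finite"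
  assumes "finite D"
  shows "cond_entropy D p f g = pair_entropy (push D p (\<lambda>a. (f a, g a)))"
proof -
  let ?P = "push D p (\<lambda>a. (f a, g a))"
  have 1: "marg D p (\<lambda>b. (f b, g b)) a = ?P (f a, g a)" for a
    by (simp add: marg_def push_def)
  have 2: "marg D p g a = (\<Sum>x\<in>UNIV. ?P (x, g a))" for a
  proof -
    have "(\<Sum>x\<in>UNIV. ?P (x, g a)) = (\<Sum>x\<in>UNIV. \<Sum>b\<in>{b \<in> {b \<in> D. g b = g a}. f b = x}. p b)"
      unfolding push_def by (intro sum.cong) auto
    also have "\<dots> = marg D p g a"
      unfolding marg_def using assms by (intro sum.group) auto
    finally show ?thesis ..
  qed
  have "cond_entropy D p f g = - (\<Sum>a\<in>D. p a * log 2 (cond_pmf ?P (f a, g a)))"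
    by (simp add: cond_entropy_def 1 2 cond_pmf_def)
  also have "\<dots> = pair_entropy ?P"
    unfolding pair_entropy_def
    by (simp add: sum_push[OF assms, of p "\<lambda>a. (f a, g a)" "\<lambda>b. log 2 (cond_pmf ?P b)"])
  finally show ?thesis .
qed

lemma marg_cong:
  assumes "finite D" "\<And>b. b \<in> D \<Longrightarrow> p b \<noteq> 0 \<Longrightarrow> f b = f a \<longleftrightarrow> g b = g a"
  shows "marg D p f a = marg D p g a"
proof -
  have "marg D p f a = (\<Sum>b\<in>D. if f b = f a then p b else 0)"
    unfolding marg_def using assms(1) by (rule sum.inter_filter)
  also have "\<dots> = (\<Sum>b\<in>D. if g b = g a then p b else 0)"
    using assms(2) by (intro sum.cong) auto
  also have "\<dots> = marg D p g a"
    unfolding marg_def using assms(1) by (rule sum.inter_filter[symmetric])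
  finally show ?thesis .
qed

text \<open>Only the partitions induced on the support of \<open>p\<close> matter. This replaces
  (X,Y) by X or Y on the diagonal, and (W,U) by U when W is constant.\<close>

lemma cond_entropy_cong:
  assumes "finite D"
    and fg: "\<And>a b. a \<in> D \<Longrightarrow> b \<in> D \<Longrightarrow> p a \<noteq> 0 \<Longrightarrow> p b \<noteq> 0 \<Longrightarrow>
      (f b = f a \<and> g b = g a) \<longleftrightarrow> (f' b = f' a \<and> g' b = g' a)"
    and g: "\<And>a b. a \<in> D \<Longrightarrow> b \<in> D \<Longrightarrow> p a \<noteq> 0 \<Longrightarrow> p b \<noteq> 0 \<Longrightarrow>
      g b = g a \<longleftrightarrow> g' b = g' a"
  shows "cond_entropy D p f g = cond_entropy D p f' g'"
proof -
  have "p a * log 2 (marg D p (\<lambda>b. (f b, g b)) a / marg D p g a)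
      = p a * log 2 (marg D p (\<lambda>b. (f' b, g' b)) a / marg D p g' a)" if "a \<in> D" for a
  proof (cases "p a = 0")
    case False
    have "marg D p (\<lambda>b. (f b, g b)) a = marg D p (\<lambda>b. (f' b, g' b)) a"
      by (rule marg_cong[OF assms(1)]) (use fg that False in auto)
    moreover have "marg D p g a = marg D p g' a"
      by (rule marg_cong[OF assms(1)]) (use g that False in auto)
    ultimately show ?thesis by simp
  qed simp
  then show ?thesis
    unfolding cond_entropy_def by (intro arg_cong[of _ _ uminus] sum.cong refl)
qed

definition pmf_XU :: "('x \<times> 'y \<times> 'u \<times> 'v \<Rightarrow> real) \<Rightarrow> 'x \<times> 'u \<Rightarrow> real" where
  "pmf_XU Q = push UNIV Q (\<lambda>(x, y, u, v). (x, u))"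

definition pmf_YV :: "('x \<times> 'y \<times> 'u \<times> 'v \<Rightarrow> real) \<Rightarrow> 'y \<times> 'v \<Rightarrow> real" where
  "pmf_YV Q = push UNIV Q (\<lambda>(x, y, u, v). (y, v))"

lemma pair_source_push:
  fixes Q :: "'a::finite \<Rightarrow> real"
  assumes "\<forall>a. 0 \<le> Q a" "(\<Sum>a\<in>UNIV. Q a) = 1"
  shows "pair_source (push UNIV Q h)"
proof
  show "0 \<le> push UNIV Q h b" for b
    using assms by (simp add: push_def sum_nonneg)
  show "(\<Sum>b\<in>UNIV. push UNIV Q h b) = 1"
    using assms sum_push[of UNIV Q h "\<lambda>_. 1"] by simp
qed

section \<open>The single-letter region on the diagonal\<close>

definition two_decoder_region ::
    "('x::finite \<times> 'y::finite \<times> 'u::finite \<times> 'v::finite \<Rightarrow> real) \<Rightarrow> (real \<times> real \<times> real) set" where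
  "two_decoder_region Q = {(R0, R1, R2). 0 \<le> R0 \<and> 0 \<le> R1 \<and> 0 \<le> R2 \<and>
      pair_entropy (pmf_XU Q) \<le> R0 + R1 \<and> pair_entropy (pmf_YV Q) \<le> R0 + R2}"

lemma closed_two_decoder_region: "closed (two_decoder_region Q)"
  unfolding two_decoder_region_def case_prod_unfold
  by (intro closed_Collect_conj closed_Collect_le continuous_intros)

lemma finite_Dom: "finite (Dom TYPE('x::finite) TYPE('y::finite) :: (nat \<times> 'x \<times> 'y \<times> 'u::finite \<times> 'v::finite) set)"
  by (simp add: Dom_def Walph_def)

text \<open>Summing out W returns \<open>Q\<close>, so the law of any function of the source letter
  is the same for every \<open>p\<close> in the family.\<close>

lemma push_Pfam:
  fixes Q :: "'x::finite \<times> 'y::finite \<times> 'u::finite \<times> 'v::finite \<Rightarrow> real"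
  assumes "p \<in> Pfam Q"
  shows "push (Dom TYPE('x) TYPE('y)) p (\<lambda>a. h (snd a)) = push UNIV Q h"
proof
  fix b
  have "{a \<in> Dom TYPE('x) TYPE('y). h (snd a) = b} = Walph TYPE('x) TYPE('y) \<times> {z. h z = b}"
    by (auto simp: Dom_def)
  then have "push (Dom TYPE('x) TYPE('y)) p (\<lambda>a. h (snd a)) b
      = (\<Sum>w\<in>Walph TYPE('x) TYPE('y). \<Sum>z | h z = b. p (w, z))"
    by (simp add: push_def sum.cartesian_product)
  also have "\<dots> = (\<Sum>z | h z = b. \<Sum>w\<in>Walph TYPE('x) TYPE('y). p (w, z))"
    by (rule sum.swap)
  also have "\<dots> = push UNIV Q h b"
    using assms unfolding push_def Pfam_def by (intro sum.cong) auto
  finally show "push (Dom TYPE('x) TYPE('y)) p (\<lambda>a. h (snd a)) b = push UNIV Q h b" .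
qed

text \<open>With X = Y, the pair (X,Y) carries the same information as X or Y alone, so the mutual
  informations become H(X|U) - h and H(Y|V) - k. Thus \<open>p\<close> enters only through h =
  H(X|W,U) and k = H(Y|W,V).\<close>

lemma Rout_diagonal:
  fixes Q :: "'x::finite \<times> 'x \<times> 'u::finite \<times> 'v::finite \<Rightarrow> real"
  assumes diag: "\<forall>x y u v. x \<noteq> y \<longrightarrow> Q (x, y, u, v) = 0" and p: "p \<in> Pfam Q"
  obtains h k where
    "Rout p = {(R0, R1, R2). 0 \<le> R0 \<and> 0 \<le> R1 \<and> 0 \<le> R2 \<and>
        max (pair_entropy (pmf_XU Q) - h) (pair_entropy (pmf_YV Q) - k) \<le> R0 \<and>
        max (pair_entropy (pmf_XU Q) - h) (pair_entropy (pmf_YV Q) - k) + h \<le> R0 + R1 \<and>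
        max (pair_entropy (pmf_XU Q) - h) (pair_entropy (pmf_YV Q) - k) + k \<le> R0 + R2}"
    "h = cond_entropy (Dom TYPE('x) TYPE('x)) p (\<lambda>(w,x,y,u,v). x) (\<lambda>a. ((\<lambda>(w,x,y,u,v). w) a, (\<lambda>(w,x,y,u,v). u) a))"
    "k = cond_entropy (Dom TYPE('x) TYPE('x)) p (\<lambda>(w,x,y,u,v). y) (\<lambda>a. ((\<lambda>(w,x,y,u,v). w) a, (\<lambda>(w,x,y,u,v). v) a))"
proof -
  let ?D = "Dom TYPE('x) TYPE('x) :: (nat \<times> 'x \<times> 'x \<times> 'u \<times> 'v) set"
  \<comment> \<open>The factorization of \<open>p\<close> through \<open>Q\<close> transfers the
    diagonal support.\<close>
  have supp: "x = y" if "p (w, x, y, u, v) \<noteq> 0" for w x y u v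
  proof -
    obtain c where "\<forall>w x y u v. p (w, x, y, u, v) = c w x y * Q (x, y, u, v)"
      using p unfolding Pfam_def by blast
    then show ?thesis using diag that by (metis mult_zero_right)
  qed
  have XU: "cond_entropy ?D p (\<lambda>(w,x,y,u,v). (x,y)) (\<lambda>(w,x,y,u,v). u) = pair_entropy (pmf_XU Q)"
  proof -
    have "cond_entropy ?D p (\<lambda>(w,x,y,u,v). (x,y)) (\<lambda>(w,x,y,u,v). u)
        = cond_entropy ?D p (\<lambda>(w,x,y,u,v). x) (\<lambda>(w,x,y,u,v). u)"
      by (rule cond_entropy_cong[OF finite_Dom]) (auto dest!: supp)
    also have "\<dots> = pair_entropy (push ?D p (\<lambda>a. (\<lambda>(x,y,u,v). (x, u)) (snd a)))"
      by (simp add: cond_entropy_eq_pair_entropy[OF finite_Dom] case_prod_unfold)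
    finally show ?thesis by (simp only: push_Pfam[OF p] pmf_XU_def)
  qed
  have YV: "cond_entropy ?D p (\<lambda>(w,x,y,u,v). (x,y)) (\<lambda>(w,x,y,u,v). v) = pair_entropy (pmf_YV Q)"
  proof -
    have "cond_entropy ?D p (\<lambda>(w,x,y,u,v). (x,y)) (\<lambda>(w,x,y,u,v). v)
        = cond_entropy ?D p (\<lambda>(w,x,y,u,v). y) (\<lambda>(w,x,y,u,v). v)"
      by (rule cond_entropy_cong[OF finite_Dom]) (auto dest!: supp)
    also have "\<dots> = pair_entropy (push ?D p (\<lambda>a. (\<lambda>(x,y,u,v). (y, v)) (snd a)))"
      by (simp add: cond_entropy_eq_pair_entropy[OF finite_Dom] case_prod_unfold)
    finally show ?thesis by (simp only: push_Pfam[OF p] pmf_YV_def)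
  qed
  have XWU: "cond_entropy ?D p (\<lambda>(w,x,y,u,v). (x,y)) (\<lambda>a. ((\<lambda>(w,x,y,u,v). w) a, (\<lambda>(w,x,y,u,v). u) a))
      = cond_entropy ?D p (\<lambda>(w,x,y,u,v). x) (\<lambda>a. ((\<lambda>(w,x,y,u,v). w) a, (\<lambda>(w,x,y,u,v). u) a))"
    by (rule cond_entropy_cong[OF finite_Dom]) (auto dest!: supp)
  have YWV: "cond_entropy ?D p (\<lambda>(w,x,y,u,v). (x,y)) (\<lambda>a. ((\<lambda>(w,x,y,u,v). w) a, (\<lambda>(w,x,y,u,v). v) a))
      = cond_entropy ?D p (\<lambda>(w,x,y,u,v). y) (\<lambda>a. ((\<lambda>(w,x,y,u,v). w) a, (\<lambda>(w,x,y,u,v). v) a))"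
    by (rule cond_entropy_cong[OF finite_Dom]) (auto dest!: supp)
  show ?thesis
    by (rule that[OF _ refl refl]) (simp only: Rout_def Let_def cond_mutual_info_def XU YV XWU YWV)
qed

lemma Union_Rout_diagonal:
  fixes Q :: "'x::finite \<times> 'x \<times> 'u::finite \<times> 'v::finite \<Rightarrow> real"
  assumes Q0: "\<forall>a. 0 \<le> Q a" and diag: "\<forall>x y u v. x \<noteq> y \<longrightarrow> Q (x, y, u, v) = 0"
  shows "(\<Union>p\<in>Pfam Q. Rout p) = two_decoder_region Q"
proof (intro equalityI UN_least)
  fix p assume "p \<in> Pfam Q"
  then show "Rout p \<subseteq> two_decoder_region Q"
    by (rule Rout_diagonal[OF diag]) (auto simp: two_decoder_region_def)
next
  let ?D = "Dom TYPE('x) TYPE('x) :: (nat \<times> 'x \<times> 'x \<times> 'u \<times> 'v) set"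
  \<comment> \<open>The constant choice W = 0: then h = H(X|U) and k = H(Y|V), so J is 0 and the
    constraints become those of the target region.\<close>
  define p :: "nat \<times> 'x \<times> 'x \<times> 'u \<times> 'v \<Rightarrow> real"
    where "p = (\<lambda>(w, z). if w = 0 then Q z else 0)"
  have p: "p \<in> Pfam Q"
    unfolding Pfam_def
    using Q0 by (auto simp: p_def Walph_def intro!: exI[of _ "\<lambda>w x y. of_bool (w = 0)"])
  have X: "cond_entropy ?D p (\<lambda>(w,x,y,u,v). x) (\<lambda>a. ((\<lambda>(w,x,y,u,v). w) a, (\<lambda>(w,x,y,u,v). u) a))
      = pair_entropy (pmf_XU Q)"
  proof -
    have "cond_entropy ?D p (\<lambda>(w,x,y,u,v). x) (\<lambda>a. ((\<lambda>(w,x,y,u,v). w) a, (\<lambda>(w,x,y,u,v). u) a))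
        = cond_entropy ?D p (\<lambda>(w,x,y,u,v). x) (\<lambda>(w,x,y,u,v). u)"
      by (rule cond_entropy_cong[OF finite_Dom]) (auto simp: p_def split: if_splits)
    also have "\<dots> = pair_entropy (push ?D p (\<lambda>a. (\<lambda>(x,y,u,v). (x, u)) (snd a)))"
      by (simp add: cond_entropy_eq_pair_entropy[OF finite_Dom] case_prod_unfold)
    finally show ?thesis by (simp only: push_Pfam[OF p] pmf_XU_def)
  qed
  have Y: "cond_entropy ?D p (\<lambda>(w,x,y,u,v). y) (\<lambda>a. ((\<lambda>(w,x,y,u,v). w) a, (\<lambda>(w,x,y,u,v). v) a))
      = pair_entropy (pmf_YV Q)"
  proof -
    have "cond_entropy ?D p (\<lambda>(w,x,y,u,v). y) (\<lambda>a. ((\<lambda>(w,x,y,u,v). w) a, (\<lambda>(w,x,y,u,v). v) a))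
        = cond_entropy ?D p (\<lambda>(w,x,y,u,v). y) (\<lambda>(w,x,y,u,v). v)"
      by (rule cond_entropy_cong[OF finite_Dom]) (auto simp: p_def split: if_splits)
    also have "\<dots> = pair_entropy (push ?D p (\<lambda>a. (\<lambda>(x,y,u,v). (y, v)) (snd a)))"
      by (simp add: cond_entropy_eq_pair_entropy[OF finite_Dom] case_prod_unfold)
    finally show ?thesis by (simp only: push_Pfam[OF p] pmf_YV_def)
  qed
  have "two_decoder_region Q = Rout p"
    by (rule Rout_diagonal[OF diag p], simp only: X Y) (auto simp: two_decoder_region_def)
  then show "two_decoder_region Q \<subseteq> (\<Union>p\<in>Pfam Q. Rout p)"
    using p by blast
qed

section \<open>Error probabilities and codes on the diagonal\<close>

lemma Xs_eq_Ys:
  fixes Q :: "'x \<times> 'x \<times> 'u \<times> 'v \<Rightarrow> real"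
  assumes "\<forall>x y u v. x \<noteq> y \<longrightarrow> Q (x, y, u, v) = 0" "seq_prob Q s \<noteq> 0"
  shows "Xs s = Ys s"
  using assms(2)
proof (induction s)
  case (Cons a s)
  obtain x y u v where a: "a = (x, y, u, v)" by (cases a)
  with Cons.prems assms(1) have "x = y" by auto
  with Cons a show ?case by (simp add: Xs_def Ys_def)
qed (simp add: Xs_def Ys_def)

text \<open>Off-diagonal blocks have weight 0, so the encoder may be fed x^n twice. The error event
  then involves only x^n and u^n, and the block law reduces to that of pairs.\<close>

lemma err_x_diagonal:
  fixes Q :: "'x::finite \<times> 'x \<times> 'u::finite \<times> 'v::finite \<Rightarrow> real"
  assumes "\<forall>x y u v. x \<noteq> y \<longrightarrow> Q (x, y, u, v) = 0"
  shows "err_x Q n e dx = (\<Sum>t | length t = n. seq_prob (pmf_XU Q) t *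
    of_bool (case e (map fst t) (map fst t) of (m0, m1, m2) \<Rightarrow> dx m0 m1 (map snd t) \<noteq> map fst t))"
proof -
  let ?h = "\<lambda>(x, y, u, v). (x, u)"
  let ?F = "\<lambda>t. of_bool (case e (map fst t) (map fst t) of
      (m0, m1, m2) \<Rightarrow> dx m0 m1 (map snd t) \<noteq> map fst t) :: real"
  have "err_x Q n e dx = (\<Sum>s | length s = n. seq_prob Q s *
    ?F (map ?h s))"
    unfolding err_x_def
  proof (intro sum.cong refl)
    fix s :: "('x \<times> 'x \<times> 'u \<times> 'v) list"
    have "map fst (map ?h s) = Xs s" "map snd (map ?h s) = Us s"
      by (auto simp: Xs_def Us_def)
    then show "seq_prob Q s * (let (m0, m1, m2) = e (Xs s) (Ys s) in if dx m0 m1 (Us s) \<noteq> Xs s then 1 else 0)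
      = seq_prob Q s * ?F (map ?h s)"
      using Xs_eq_Ys[OF assms, of s] by (cases "seq_prob Q s = 0") (auto split: prod.splits)
  qed
  also have "\<dots> = (\<Sum>t | length t = n. seq_prob (pmf_XU Q) t * ?F t)"
    unfolding pmf_XU_def by (rule sum_seq_prob_push)
  finally show ?thesis .
qed

lemma err_y_diagonal:
  fixes Q :: "'x::finite \<times> 'x \<times> 'u::finite \<times> 'v::finite \<Rightarrow> real"
  assumes "\<forall>x y u v. x \<noteq> y \<longrightarrow> Q (x, y, u, v) = 0"
  shows "err_y Q n e dy = (\<Sum>t | length t = n. seq_prob (pmf_YV Q) t *
    of_bool (case e (map fst t) (map fst t) of (m0, m1, m2) \<Rightarrow> dy m0 m2 (map snd t) \<noteq> map fst t))"
proof -
  let ?h = "\<lambda>(x, y, u, v). (y, v)"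
  let ?F = "\<lambda>t. of_bool (case e (map fst t) (map fst t) of
      (m0, m1, m2) \<Rightarrow> dy m0 m2 (map snd t) \<noteq> map fst t) :: real"
  have "err_y Q n e dy = (\<Sum>s | length s = n. seq_prob Q s *
    ?F (map ?h s))"
    unfolding err_y_def
  proof (intro sum.cong refl)
    fix s :: "('x \<times> 'x \<times> 'u \<times> 'v) list"
    have "map fst (map ?h s) = Ys s" "map snd (map ?h s) = Vs s"
      by (auto simp: Ys_def Vs_def)
    then show "seq_prob Q s * (let (m0, m1, m2) = e (Xs s) (Ys s) in if dy m0 m2 (Vs s) \<noteq> Ys s then 1 else 0)
      = seq_prob Q s * ?F (map ?h s)"
      using Xs_eq_Ys[OF assms, of s] by (cases "seq_prob Q s = 0") (auto split: prod.splits)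
  qed
  also have "\<dots> = (\<Sum>t | length t = n. seq_prob (pmf_YV Q) t * ?F t)"
    unfolding pmf_YV_def by (rule sum_seq_prob_push)
  finally show ?thesis .
qed

lemma le_powr_of_rate_le:
  assumes "0 < n" "0 < M" "log 2 (real M) / real n \<le> R"
  shows "real M \<le> 2 powr (n * R)"
proof -
  have "log 2 (real M) \<le> n * R" using assms by (simp add: field_simps)
  then show ?thesis using assms by (simp add: log_le_iff)
qed

text \<open>The statement under the quantifiers of \<open>achievable\<close>, named so that converse
  and achievability can handle one code at a time.\<close>

definition is_code :: "('x \<times> 'y \<times> 'u \<times> 'v \<Rightarrow> real) \<Rightarrow> real \<times> real \<times> real \<Rightarrow> real \<Rightarrow> nat \<Rightarrow> nat \<Rightarrow> nat \<Rightarrow> nat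
    \<Rightarrow> ('x list \<Rightarrow> 'y list \<Rightarrow> nat \<times> nat \<times> nat) \<Rightarrow> (nat \<Rightarrow> nat \<Rightarrow> 'u list \<Rightarrow> 'x list)
    \<Rightarrow> (nat \<Rightarrow> nat \<Rightarrow> 'v list \<Rightarrow> 'y list) \<Rightarrow> bool" where
  "is_code Q R \<epsilon> n M0 M1 M2 e dx dy \<longleftrightarrow> 0 < M0 \<and> 0 < M1 \<and> 0 < M2 \<and>
    (\<forall>xs ys. length xs = n \<longrightarrow> length ys = n \<longrightarrow> e xs ys \<in> {1..M0} \<times> {1..M1} \<times> {1..M2}) \<and>
    max (err_x Q n e dx) (err_y Q n e dy) \<le> \<epsilon> \<and>
    log 2 (real M0) / real n \<le> fst R + \<epsilon> \<and>
    log 2 (real M1) / real n \<le> fst (snd R) + \<epsilon> \<and>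
    log 2 (real M2) / real n \<le> snd (snd R) + \<epsilon>"

lemma achievable_iff_is_code:
  "achievable Q R \<longleftrightarrow>
    (\<forall>\<epsilon>>0. \<exists>N. \<forall>n\<ge>N. \<exists>M0 M1 M2 e dx dy. is_code Q R \<epsilon> n M0 M1 M2 e dx dy)"
  unfolding achievable_def is_code_def case_prod_unfold ..

section \<open>Converse\<close>

lemma achievable_imp_region:
  fixes Q :: "'x::finite \<times> 'x \<times> 'u::finite \<times> 'v::finite \<Rightarrow> real"
  assumes Q0: "\<forall>a. 0 \<le> Q a" and Q1: "(\<Sum>a\<in>UNIV. Q a) = 1"
    and diag: "\<forall>x y u v. x \<noteq> y \<longrightarrow> Q (x, y, u, v) = 0"
    and ach: "achievable Q (R0, R1, R2)"
  shows "(R0, R1, R2) \<in> two_decoder_region Q"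
proof -
  interpret X: pair_source "pmf_XU Q" unfolding pmf_XU_def by (rule pair_source_push[OF Q0 Q1])
  interpret Y: pair_source "pmf_YV Q" unfolding pmf_YV_def by (rule pair_source_push[OF Q0 Q1])
  have code: "\<exists>N. \<forall>n\<ge>N. \<exists>M0 M1 M2 e dx dy. is_code Q (R0, R1, R2) \<epsilon> n M0 M1 M2 e dx dy"
    if "0 < \<epsilon>" for \<epsilon>
    using ach that unfolding achievable_iff_is_code by blast
  \<comment> \<open>Every index set is nonempty, so its rate is nonnegative, also for
    \<open>N\<close> = 0 where the quotient is 0; letting \<epsilon> tend to 0 gives nonnegative
    rates.\<close>
  have "0 \<le> R0 + \<epsilon> \<and> 0 \<le> R1 + \<epsilon> \<and> 0 \<le> R2 + \<epsilon>" if \<epsilon>: "0 < \<epsilon>" for \<epsilon>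
  proof -
    obtain N M0 M1 M2 e dx dy where "is_code Q (R0, R1, R2) \<epsilon> N M0 M1 M2 e dx dy"
      using code[OF \<epsilon>] by blast
    then have M: "0 < M0" "0 < M1" "0 < M2"
        "log 2 (real M0) / real N \<le> R0 + \<epsilon>" "log 2 (real M1) / real N \<le> R1 + \<epsilon>"
        "log 2 (real M2) / real N \<le> R2 + \<epsilon>"
      by (simp_all add: is_code_def)
    have "0 \<le> log 2 (real M) / real N" if "0 < M" for M :: nat using that by simp
    from this[OF M(1)] this[OF M(2)] this[OF M(3)] show ?thesis using M(4-6) by linarith
  qed
  then have nonneg: "0 \<le> R0" "0 \<le> R1" "0 \<le> R2"
    using field_le_epsilon[of 0 R0] field_le_epsilon[of 0 R1] field_le_epsilon[of 0 R2] by auto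
  have "X.H \<le> R0 + R1"
  proof (rule X.converse_rate[where 'm = "nat \<times> nat"])
    fix \<epsilon> :: real assume "0 < \<epsilon>"
    then obtain N where
      N: "\<And>n. N \<le> n \<Longrightarrow> \<exists>M0 M1 M2 e dx dy. is_code Q (R0, R1, R2) \<epsilon> n M0 M1 M2 e dx dy"
      using code by blast
    show "\<exists>N. \<forall>n\<ge>N. \<exists>(K :: (nat \<times> nat) set) m d. finite K \<and> (\<forall>t. length t = n \<longrightarrow> m t \<in> K) \<and>
      (\<Sum>t | length t = n. seq_prob (pmf_XU Q) t * of_bool (d (m t) (map snd t) \<noteq> map fst t)) \<le> \<epsilon> \<and>
      (0 < n \<longrightarrow> card K \<le> 2 powr (n * (R0 + R1 + 2 * \<epsilon>)))"
    proof (intro exI[of _ N] allI impI)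
      fix n assume "N \<le> n"
      from N[OF this] obtain M0 M1 M2 e dx dy where
        "is_code Q (R0, R1, R2) \<epsilon> n M0 M1 M2 e dx dy"
        by blast
      then have c: "0 < M0" "0 < M1"
        "\<And>xs ys. length xs = n \<Longrightarrow> length ys = n \<Longrightarrow> e xs ys \<in> {1..M0} \<times> {1..M1} \<times> {1..M2}"
        "err_x Q n e dx \<le> \<epsilon>"
        "log 2 (real M0) / real n \<le> R0 + \<epsilon>" "log 2 (real M1) / real n \<le> R1 + \<epsilon>"
        by (simp_all add: is_code_def)
      \<comment> \<open>The two indices seen by the first receiver form one message, which by
        \<open>err_x_diagonal\<close> is a function of x^n.\<close>
      let ?K = "{1..M0} \<times> {1..M1}"
      let ?m = "\<lambda>t :: ('x \<times> 'u) list. case e (map fst t) (map fst t) of (m0, m1, m2) \<Rightarrow> (m0, m1)"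
      let ?d = "\<lambda>(m0, m1). dx m0 m1"
      have "?m t \<in> ?K" if "length t = n" for t
        using c(3)[of "map fst t" "map fst t"] that by auto
      moreover have "(\<Sum>t | length t = n. seq_prob (pmf_XU Q) t * of_bool (?d (?m t) (map snd t) \<noteq> map fst t)) \<le> \<epsilon>"
        using c(4) unfolding err_x_diagonal[OF diag] by (simp only: case_prod_unfold fst_conv snd_conv)
      moreover have "card ?K \<le> 2 powr (n * (R0 + R1 + 2 * \<epsilon>))" if "0 < n"
      proof -
        have "real M0 * real M1 \<le> 2 powr (n * (R0 + \<epsilon>)) * 2 powr (n * (R1 + \<epsilon>))"
          using c that by (intro mult_mono le_powr_of_rate_le) auto
        also have "\<dots> = 2 powr (n * (R0 + R1 + 2 * \<epsilon>))"
          by (simp add: powr_add[symmetric] algebra_simps)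
        finally show ?thesis by (simp add: card_cartesian_product)
      qed
      ultimately show "\<exists>(K :: (nat \<times> nat) set) m d. finite K \<and> (\<forall>t. length t = n \<longrightarrow> m t \<in> K) \<and>
        (\<Sum>t | length t = n. seq_prob (pmf_XU Q) t * of_bool (d (m t) (map snd t) \<noteq> map fst t)) \<le> \<epsilon> \<and>
        (0 < n \<longrightarrow> card K \<le> 2 powr (n * (R0 + R1 + 2 * \<epsilon>)))"
        by (intro exI[of _ ?K] exI[of _ ?m] exI[of _ ?d]) auto
    qed
  qed
  moreover have "Y.H \<le> R0 + R2"
  proof (rule Y.converse_rate[where 'm = "nat \<times> nat"])
    fix \<epsilon> :: real assume "0 < \<epsilon>"
    then obtain N where
      N: "\<And>n. N \<le> n \<Longrightarrow> \<exists>M0 M1 M2 e dx dy. is_code Q (R0, R1, R2) \<epsilon> n M0 M1 M2 e dx dy"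
      using code by blast
    show "\<exists>N. \<forall>n\<ge>N. \<exists>(K :: (nat \<times> nat) set) m d. finite K \<and> (\<forall>t. length t = n \<longrightarrow> m t \<in> K) \<and>
      (\<Sum>t | length t = n. seq_prob (pmf_YV Q) t * of_bool (d (m t) (map snd t) \<noteq> map fst t)) \<le> \<epsilon> \<and>
      (0 < n \<longrightarrow> card K \<le> 2 powr (n * (R0 + R2 + 2 * \<epsilon>)))"
    proof (intro exI[of _ N] allI impI)
      fix n assume "N \<le> n"
      from N[OF this] obtain M0 M1 M2 e dx dy where
        "is_code Q (R0, R1, R2) \<epsilon> n M0 M1 M2 e dx dy"
        by blast
      then have c: "0 < M0" "0 < M2"
        "\<And>xs ys. length xs = n \<Longrightarrow> length ys = n \<Longrightarrow> e xs ys \<in> {1..M0} \<times> {1..M1} \<times> {1..M2}"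
        "err_y Q n e dy \<le> \<epsilon>"
        "log 2 (real M0) / real n \<le> R0 + \<epsilon>" "log 2 (real M2) / real n \<le> R2 + \<epsilon>"
        by (simp_all add: is_code_def)
      let ?K = "{1..M0} \<times> {1..M2}"
      let ?m = "\<lambda>t :: ('x \<times> 'v) list. case e (map fst t) (map fst t) of (m0, m1, m2) \<Rightarrow> (m0, m2)"
      let ?d = "\<lambda>(m0, m2). dy m0 m2"
      have "?m t \<in> ?K" if "length t = n" for t
        using c(3)[of "map fst t" "map fst t"] that by auto
      moreover have "(\<Sum>t | length t = n. seq_prob (pmf_YV Q) t * of_bool (?d (?m t) (map snd t) \<noteq> map fst t)) \<le> \<epsilon>"
        using c(4) unfolding err_y_diagonal[OF diag] by (simp only: case_prod_unfold fst_conv snd_conv)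
      moreover have "card ?K \<le> 2 powr (n * (R0 + R2 + 2 * \<epsilon>))" if "0 < n"
      proof -
        have "real M0 * real M2 \<le> 2 powr (n * (R0 + \<epsilon>)) * 2 powr (n * (R2 + \<epsilon>))"
          using c that by (intro mult_mono le_powr_of_rate_le) auto
        also have "\<dots> = 2 powr (n * (R0 + R2 + 2 * \<epsilon>))"
          by (simp add: powr_add[symmetric] algebra_simps)
        finally show ?thesis by (simp add: card_cartesian_product)
      qed
      ultimately show "\<exists>(K :: (nat \<times> nat) set) m d. finite K \<and> (\<forall>t. length t = n \<longrightarrow> m t \<in> K) \<and>
        (\<Sum>t | length t = n. seq_prob (pmf_YV Q) t * of_bool (d (m t) (map snd t) \<noteq> map fst t)) \<le> \<epsilon> \<and>
        (0 < n \<longrightarrow> card K \<le> 2 powr (n * (R0 + R2 + 2 * \<epsilon>)))"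
        by (intro exI[of _ ?K] exI[of _ ?m] exI[of _ ?d]) auto
    qed
  qed
  ultimately show ?thesis using nonneg by (simp add: two_decoder_region_def)
qed

section \<open>Achievability by random binning\<close>

text \<open>Bounding the average of the sum of both errors yields a single binning that is good for
  both receivers at once; separate averages could select different binnings.\<close>

lemma binning_code_exists:
  fixes Q :: "'x::finite \<times> 'x \<times> 'u::finite \<times> 'v::finite \<Rightarrow> real"
  assumes Q0: "\<forall>a. 0 \<le> Q a" and Q1: "(\<Sum>a\<in>UNIV. Q a) = 1"
    and diag: "\<forall>x y u v. x \<noteq> y \<longrightarrow> Q (x, y, u, v) = 0"
    and n: "0 < n" and \<delta>: "0 < \<delta>" and M: "0 < (M0::nat)" "0 < (M1::nat)" "0 < (M2::nat)"
  obtains e dx dy where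
    "\<forall>xs ys. length xs = n \<longrightarrow> length ys = n \<longrightarrow> e xs ys \<in> {1..M0} \<times> {1..M1} \<times> {1..M2}"
    "err_x Q n e dx + err_y Q n e dy
      \<le> (info_var (pmf_XU Q) / (n * \<delta>\<^sup>2) + 2 powr (n * (pair_entropy (pmf_XU Q) + \<delta>)) / (real M0 * real M1))
      + (info_var (pmf_YV Q) / (n * \<delta>\<^sup>2) + 2 powr (n * (pair_entropy (pmf_YV Q) + \<delta>)) / (real M0 * real M2))"
proof -
  let ?bx = "info_var (pmf_XU Q) / (n * \<delta>\<^sup>2) + 2 powr (n * (pair_entropy (pmf_XU Q) + \<delta>)) / (real M0 * real M1)"
  let ?by = "info_var (pmf_YV Q) / (n * \<delta>\<^sup>2) + 2 powr (n * (pair_entropy (pmf_YV Q) + \<delta>)) / (real M0 * real M2)"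
  interpret X: pair_source "pmf_XU Q" unfolding pmf_XU_def by (rule pair_source_push[OF Q0 Q1])
  interpret Y: pair_source "pmf_YV Q" unfolding pmf_YV_def by (rule pair_source_push[OF Q0 Q1])
  define A where "A = {xs :: 'x list. length xs = n}"
  define B where "B = {1..M0} \<times> {1..M1} \<times> {1..M2}"
  \<comment> \<open>All assignments of index triples to blocks, with equal weight, play the role of
    the random code.\<close>
  define F where "F = (A \<rightarrow>\<^sub>E B)"
  have fin: "finite A" "finite B" by (simp_all add: A_def B_def)
  have finF: "finite F" unfolding F_def by (intro finite_PiE fin)
  have "(1, 1, 1) \<in> B" using M by (simp add: B_def)
  then have F0: "F \<noteq> {}" unfolding F_def by (auto simp: PiE_eq_empty_iff)
  define \<pi>1 :: "nat \<times> nat \<times> nat \<Rightarrow> nat \<times> nat" where "\<pi>1 = (\<lambda>(a, b, c). (a, b))"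
  define \<pi>2 :: "nat \<times> nat \<times> nat \<Rightarrow> nat \<times> nat" where "\<pi>2 = (\<lambda>(a, b, c). (a, c))"
  have cardB: "card B = M0 * M1 * M2" by (simp add: B_def card_cartesian_product)
  \<comment> \<open>Two indices fixed leave the third free, so every fibre has \<open>M2\<close>
    elements.\<close>
  have fib1: "M0 * M1 * card {b' \<in> B. \<pi>1 b' = \<pi>1 b} = card B" if "b \<in> B" for b
  proof -
    have "{b' \<in> B. \<pi>1 b' = \<pi>1 b} = {fst b} \<times> {fst (snd b)} \<times> {1..M2}"
      using that by (auto simp: B_def \<pi>1_def)
    then show ?thesis by (simp add: cardB card_cartesian_product)
  qed
  have fib2: "M0 * M2 * card {b' \<in> B. \<pi>2 b' = \<pi>2 b} = card B" if "b \<in> B" for b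
  proof -
    have "{b' \<in> B. \<pi>2 b' = \<pi>2 b} = {fst b} \<times> {1..M1} \<times> {snd (snd b)}"
      using that by (auto simp: B_def \<pi>2_def)
    then show ?thesis by (simp add: cardB card_cartesian_product)
  qed
  define dx where "dx f = (\<lambda>m0 m1. X.dec n (2 powr (- (n * (X.H + \<delta>)))) (\<lambda>xs. \<pi>1 (f xs)) (m0, m1))"
    for f :: "'x list \<Rightarrow> nat \<times> nat \<times> nat"
  define dy where "dy f = (\<lambda>m0 m2. Y.dec n (2 powr (- (n * (Y.H + \<delta>)))) (\<lambda>xs. \<pi>2 (f xs)) (m0, m2))"
    for f :: "'x list \<Rightarrow> nat \<times> nat \<times> nat"
  have ex: "err_x Q n (\<lambda>xs ys. f xs) (dx f) = (\<Sum>t | length t = n. seq_prob (pmf_XU Q) t *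
        of_bool (X.dec n (2 powr (- (n * (X.H + \<delta>)))) (\<lambda>xs. \<pi>1 (f xs)) (\<pi>1 (f (map fst t))) (map snd t) \<noteq> map fst t))" for f
    unfolding err_x_diagonal[OF diag] dx_def by (simp only: \<pi>1_def case_prod_unfold)
  have ey: "err_y Q n (\<lambda>xs ys. f xs) (dy f) = (\<Sum>t | length t = n. seq_prob (pmf_YV Q) t *
        of_bool (Y.dec n (2 powr (- (n * (Y.H + \<delta>)))) (\<lambda>xs. \<pi>2 (f xs)) (\<pi>2 (f (map fst t))) (map snd t) \<noteq> map fst t))" for f
    unfolding err_y_diagonal[OF diag] dy_def by (simp only: \<pi>2_def case_prod_unfold)
  have "(\<Sum>f\<in>F. err_x Q n (\<lambda>xs ys. f xs) (dx f)) \<le> card F * ?bx"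
    unfolding ex
  proof (rule X.average_dec_error_le[OF finF _ n \<delta>])
    fix xs xs' :: "'x list" assume "length xs = n" "length xs' = n" "xs \<noteq> xs'"
    then have "(\<Sum>f\<in>F. of_bool (\<pi>1 (f xs) = \<pi>1 (f xs'))) \<le> real (card F) / real (M0 * M1)"
      unfolding F_def using fin M by (intro collision_average fib1) (auto simp: A_def)
    then show "(\<Sum>f\<in>F. of_bool (\<pi>1 (f xs) = \<pi>1 (f xs'))) \<le> real (card F) / (real M0 * real M1)"
      by (simp only: of_nat_mult)
  qed (use M in simp)
  moreover have "(\<Sum>f\<in>F. err_y Q n (\<lambda>xs ys. f xs) (dy f)) \<le> card F * ?by"
    unfolding ey
  proof (rule Y.average_dec_error_le[OF finF _ n \<delta>])
    fix xs xs' :: "'x list" assume "length xs = n" "length xs' = n" "xs \<noteq> xs'"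
    then have "(\<Sum>f\<in>F. of_bool (\<pi>2 (f xs) = \<pi>2 (f xs'))) \<le> real (card F) / real (M0 * M2)"
      unfolding F_def using fin M by (intro collision_average fib2) (auto simp: A_def)
    then show "(\<Sum>f\<in>F. of_bool (\<pi>2 (f xs) = \<pi>2 (f xs'))) \<le> real (card F) / (real M0 * real M2)"
      by (simp only: of_nat_mult)
  qed (use M in simp)
  ultimately have sum_le: "(\<Sum>f\<in>F. err_x Q n (\<lambda>xs ys. f xs) (dx f) + err_y Q n (\<lambda>xs ys. f xs) (dy f))
      \<le> (\<Sum>f\<in>F. ?bx + ?by)"
    by (simp add: sum.distrib distrib_left)
  \<comment> \<open>Some binning does no worse than the average.\<close>
  have "\<exists>f\<in>F. err_x Q n (\<lambda>xs ys. f xs) (dx f) + err_y Q n (\<lambda>xs ys. f xs) (dy f) \<le> ?bx + ?by"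
  proof (rule ccontr)
    assume "\<not> ?thesis"
    then have "(\<Sum>f\<in>F. ?bx + ?by)
        < (\<Sum>f\<in>F. err_x Q n (\<lambda>xs ys. f xs) (dx f) + err_y Q n (\<lambda>xs ys. f xs) (dy f))"
      using finF F0 by (intro sum_strict_mono) (auto simp: not_le)
    then show False using sum_le by linarith
  qed
  then obtain f where f: "f \<in> F"
      "err_x Q n (\<lambda>xs ys. f xs) (dx f) + err_y Q n (\<lambda>xs ys. f xs) (dy f) \<le> ?bx + ?by"
    by blast
  have "f xs \<in> B" if "length xs = n" for xs
    using f(1) that unfolding F_def A_def by (auto dest: PiE_mem)
  then show ?thesis
    using f(2) by (intro that[of "\<lambda>xs ys. f xs" "dx f" "dy f"]) (simp_all add: B_def)
qed

text \<open>The largest index set of rate at most a. Since the power is at least 1, rounding down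
  loses at most a factor 2.\<close>

lemma floor_powr_rate:
  assumes "0 \<le> a" "0 < n" and M: "M = nat \<lfloor>2 powr (real n * a)\<rfloor>"
  shows "0 < M" "log 2 (real M) / real n \<le> a" "2 powr (real n * a) / 2 \<le> real M"
proof -
  have y: "1 \<le> 2 powr (real n * a)" using assms by (simp add: ge_one_powr_ge_zero)
  then have fl: "1 \<le> \<lfloor>2 powr (real n * a)\<rfloor>" by simp
  then show "0 < M" by (simp add: M)
  have Mr: "real M = \<lfloor>2 powr (real n * a)\<rfloor>" using fl by (simp add: M)
  then have "real M \<le> 2 powr (real n * a)" by simp
  then have "log 2 (real M) \<le> real n * a" using \<open>0 < M\<close> by (simp add: log_le_iff)
  then show "log 2 (real M) / real n \<le> a" using assms by (simp add: field_simps)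
  have "2 powr (real n * a) < real M + 1" "1 \<le> real M" unfolding Mr using fl by linarith+
  then show "2 powr (real n * a) / 2 \<le> real M" by linarith
qed

text \<open>The two bin counts contribute 2 \<epsilon> to the exponent against one \<epsilon> from
  the threshold, leaving a decay with exponent -n \<epsilon>; the factor 4 comes from rounding
  twice.\<close>

lemma powr_div_bins_le:
  assumes "H \<le> a + b" "2 powr (real n * (a + \<epsilon>)) / 2 \<le> M" "2 powr (real n * (b + \<epsilon>)) / 2 \<le> M'"
  shows "2 powr (real n * (H + \<epsilon>)) / (M * M') \<le> 4 * 2 powr (- (real n * \<epsilon>))"
proof -
  have pos: "0 < M" "0 < M'" using assms(2,3) by (smt (verit) half_gt_zero powr_gt_zero)+
  have "2 powr (real n * (H + \<epsilon>)) \<le> 2 powr (real n * (a + b + \<epsilon>))"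
    using assms(1) by (intro powr_mono mult_left_mono) auto
  also have "\<dots> = 4 * 2 powr (- (real n * \<epsilon>))
      * ((2 powr (real n * (a + \<epsilon>)) / 2) * (2 powr (real n * (b + \<epsilon>)) / 2))"
    by (simp add: powr_add[symmetric] algebra_simps)
  also have "\<dots> \<le> 4 * 2 powr (- (real n * \<epsilon>)) * (M * M')"
    using assms(2,3) pos by (intro mult_left_mono mult_mono) auto
  finally show ?thesis using pos by (simp add: field_simps)
qed

lemma region_imp_achievable:
  fixes Q :: "'x::finite \<times> 'x \<times> 'u::finite \<times> 'v::finite \<Rightarrow> real"
  assumes Q0: "\<forall>a. 0 \<le> Q a" and Q1: "(\<Sum>a\<in>UNIV. Q a) = 1"
    and diag: "\<forall>x y u v. x \<noteq> y \<longrightarrow> Q (x, y, u, v) = 0"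
    and reg: "(R0, R1, R2) \<in> two_decoder_region Q"
  shows "achievable Q (R0, R1, R2)"
proof -
  interpret X: pair_source "pmf_XU Q" unfolding pmf_XU_def by (rule pair_source_push[OF Q0 Q1])
  interpret Y: pair_source "pmf_YV Q" unfolding pmf_YV_def by (rule pair_source_push[OF Q0 Q1])
  have R: "0 \<le> R0" "0 \<le> R1" "0 \<le> R2" "X.H \<le> R0 + R1" "Y.H \<le> R0 + R2"
    using reg by (auto simp: two_decoder_region_def)
  have err_nonneg: "0 \<le> err_x Q n e dx" "0 \<le> err_y Q n e dy" for n e dx dy
    unfolding err_x_diagonal[OF diag] err_y_diagonal[OF diag]
    by (auto intro!: sum_nonneg seq_prob_nonneg X.P_nonneg Y.P_nonneg)
  have "\<exists>N. \<forall>n\<ge>N. \<exists>M0 M1 M2 e dx dy. is_code Q (R0, R1, R2) \<epsilon> n M0 M1 M2 e dx dy"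
    if \<epsilon>: "0 < \<epsilon>" for \<epsilon>
  proof -
    \<comment> \<open>The same \<epsilon> serves as typicality slack, rate excess and error target;
      the block-length bound \<open>?b\<close> tends to 0.\<close>
    let ?b = "\<lambda>n::nat. (info_var (pmf_XU Q) / (n * \<epsilon>\<^sup>2) + 4 * 2 powr (- (n * \<epsilon>)))
      + (info_var (pmf_YV Q) / (n * \<epsilon>\<^sup>2) + 4 * 2 powr (- (n * \<epsilon>)))"
    have "(\<lambda>n. c / (real n * \<epsilon>\<^sup>2) + 4 * 2 powr (- (real n * \<epsilon>))) \<longlonglongrightarrow> 0" for c
      using chebyshev_powr_tendsto_0[OF \<epsilon>] .
    from tendsto_add[OF this this] have "?b \<longlonglongrightarrow> 0" by simp
    then have "\<forall>\<^sub>F n in sequentially. ?b n < \<epsilon>" using \<epsilon> by (rule order_tendstoD)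
    then obtain N where N: "\<And>n. N \<le> n \<Longrightarrow> ?b n < \<epsilon>"
      by (auto simp: eventually_sequentially)
    show ?thesis
    proof (rule exI[of _ "Suc N"], intro allI impI)
      fix n assume "Suc N \<le> n"
      then have n: "0 < n" "N \<le> n" by auto
      define M0 where "M0 = nat \<lfloor>2 powr (real n * (R0 + \<epsilon>))\<rfloor>"
      define M1 where "M1 = nat \<lfloor>2 powr (real n * (R1 + \<epsilon>))\<rfloor>"
      define M2 where "M2 = nat \<lfloor>2 powr (real n * (R2 + \<epsilon>))\<rfloor>"
      have nn: "0 \<le> R0 + \<epsilon>" "0 \<le> R1 + \<epsilon>" "0 \<le> R2 + \<epsilon>" using R \<epsilon> by auto
      note f0 = floor_powr_rate[OF nn(1) n(1) M0_def]
      note f1 = floor_powr_rate[OF nn(2) n(1) M1_def]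
      note f2 = floor_powr_rate[OF nn(3) n(1) M2_def]
      obtain e dx dy where
          e: "\<forall>xs ys. length xs = n \<longrightarrow> length ys = n \<longrightarrow> e xs ys \<in> {1..M0} \<times> {1..M1} \<times> {1..M2}"
        and err: "err_x Q n e dx + err_y Q n e dy
          \<le> (info_var (pmf_XU Q) / (n * \<epsilon>\<^sup>2) + 2 powr (n * (X.H + \<epsilon>)) / (real M0 * real M1))
          + (info_var (pmf_YV Q) / (n * \<epsilon>\<^sup>2) + 2 powr (n * (Y.H + \<epsilon>)) / (real M0 * real M2))"
        by (rule binning_code_exists[OF Q0 Q1 diag n(1) \<epsilon> f0(1) f1(1) f2(1)])
      have "err_x Q n e dx + err_y Q n e dy \<le> ?b n"
        using err powr_div_bins_le[OF R(4) f0(3) f1(3)] powr_div_bins_le[OF R(5) f0(3) f2(3)]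
        by simp
      \<comment> \<open>Both errors are nonnegative, so their sum dominates their maximum.\<close>
      then have "max (err_x Q n e dx) (err_y Q n e dy) \<le> \<epsilon>"
        using N[OF n(2)] err_nonneg(1)[of n e dx] err_nonneg(2)[of n e dy] by linarith
      then have "is_code Q (R0, R1, R2) \<epsilon> n M0 M1 M2 e dx dy"
        using e f0 f1 f2 by (simp add: is_code_def)
      then show "\<exists>M0 M1 M2 e dx dy. is_code Q (R0, R1, R2) \<epsilon> n M0 M1 M2 e dx dy"
        by blast
    qed
  qed
  then show ?thesis unfolding achievable_iff_is_code by blast
qed

theorem theorem3:
  fixes Q :: "'x::finite \<times> 'x \<times> 'u::finite \<times> 'v::finite \<Rightarrow> real"
  assumes "\<forall>a. 0 \<le> Q a"
    and "(\<Sum>a\<in>UNIV. Q a) = 1"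
    and "\<forall>x y u v. x \<noteq> y \<longrightarrow> Q (x, y, u, v) = 0"
  shows "{R. achievable Q R} = closure (\<Union>p\<in>Pfam Q. Rout p)"
proof -
  have "achievable Q R \<longleftrightarrow> R \<in> two_decoder_region Q" for R
    using achievable_imp_region[OF assms] region_imp_achievable[OF assms]
    by (cases R) blast
  then show ?thesis
    by (simp add: Union_Rout_diagonal[OF assms(1,3)] closed_two_decoder_region closure_closed)
qed

end
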